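(* Let $\mathcal{A}$ be a finite alphabet, $\Omega=\mathcal{A}^{\mathbb{N}}$, $\sigma$ the shift on $\Omega$, and $\mu$ a $\sigma$-invariant ergodic Borel probability measure on $\Omega$. Let $Z$ be a coarsely optimal compression algorithm. Then for $\mu$-almost every $\omega\in\Omega$, \[ K_Z(\omega)=\hat H(\omega)=K_{AIC}(\omega)=h_\mu(\sigma), \] where $h_\mu(\sigma)$ is the Kolmogorov–Sinai entropy of $(\Omega,\mu,\sigma)$.
   Context: All logarithms are in base 2 and entropies are computed with base-2 logarithms. $\Sigma(\mathcal{A})$ denotes the set of finite strings over $\mathcal{A}$ (including the empty string), and $|s|$ the length of a string $s$. For $\omega=(\omega_i)_{i\ge1}\in\Omega$, $\omega^n=(\omega_1,\dots,\omega_n)$. Algorithmic Information Content: fix a universal partial recursive function $U:\Sigma(\{0,1\})\to\Sigma(\mathcal{A})$; $I_{AIC}(s)=\min\{|p|: U(p)=s\}$, and $K_{AIC}(\omega)=\limsup_{n\to\infty} I_{AIC}(\omega^n)/n$. A compression algorithm is a total recursive injective (lossless) map $Z:\Sigma(\mathcal{A})\to\Sigma(\{0,1\})$; $K_Z(\omega)=\limsup_{n\to\infty}|Z(\omega^n)|/n$. Empirical entropy: for a string $s$ of length $n$, a word $w\in\mathcal{A}^l$ ($l\le n$), let $P(s,w)=\frac{1}{n-l+1}\#\{0\le i\le n-l: (s_{i+1},\dots,s_{i+l})=w\}$ and $\hat H_l(s)=-\frac1l\sum_{w\in\mathcal{A}^l}P(s,w)\log P(s,w)$ (with $0\log 0=0$).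 For $\omega\in\Omega$, $\hat H_l(\omega)=\limsup_{n\to\infty}\hat H_l(\omega^n)$ and $\hat H(\omega)=\lim_{l\to\infty}\hat H_l(\omega)$ (this limit exists). $Z$ is coarsely optimal if for every $k\ge1$ there is a function $f_k$ with $f_k(n)=o(n)$ such that for every finite string $s$, $|Z(s)|\le |s|\hat H_k(s)+f_k(|s|)$. *)

theory Defs
  imports "HOL-Probability.Probability" "HOL-Library.Nat_Bijection" "HOL-Library.Landau_Symbols"
begin

datatype recf = RZ | RS | RProj nat | RComp recf "recf list" | RPrec recf recf | RMn recf

inductive evalr :: "recf \<Rightarrow> nat list \<Rightarrow> nat \<Rightarrow> bool" where
  ev_zero: "evalr RZ xs 0"
| ev_succ: "evalr RS (x # xs) (Suc x)"
| ev_proj: "i < length xs \<Longrightarrow> evalr (RProj i) xs (xs ! i)"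
| ev_comp: "length ys = length gs \<Longrightarrow> (\<forall>i < length gs. evalr (gs ! i) xs (ys ! i))
             \<Longrightarrow> evalr f ys z \<Longrightarrow> evalr (RComp f gs) xs z"
| ev_prec0: "evalr f xs y \<Longrightarrow> evalr (RPrec f g) (0 # xs) y"
| ev_precS: "evalr (RPrec f g) (n # xs) r \<Longrightarrow> evalr g (r # n # xs) y
             \<Longrightarrow> evalr (RPrec f g) (Suc n # xs) y"
| ev_mn: "evalr f (n # xs) 0 \<Longrightarrow> (\<forall>m < n. \<exists>y. evalr f (m # xs) (Suc y))
             \<Longrightarrow> evalr (RMn f) xs n"

definition partrec_nat :: "(nat \<Rightarrow> nat option) \<Rightarrow> bool" where
  "partrec_nat g \<longleftrightarrow> (\<exists>f. \<forall>x y. evalr f [x] y \<longleftrightarrow> g x = Some y)"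

definition sym_index :: "'a::finite \<Rightarrow> nat" where
  "sym_index = (SOME f. bij_betw f (UNIV::'a set) {..<CARD('a)})"

definition str_code :: "'a::finite list \<Rightarrow> nat" where
  "str_code xs = list_encode (map sym_index xs)"

definition partial_recursive :: "('a::finite list \<Rightarrow> 'b::finite list option) \<Rightarrow> bool" where
  "partial_recursive F \<longleftrightarrow>
     (\<exists>g. partrec_nat g \<and> (\<forall>xs. g (str_code xs) = map_option str_code (F xs)))"

definition total_recursive :: "('a::finite list \<Rightarrow> 'b::finite list) \<Rightarrow> bool" where
  "total_recursive F \<longleftrightarrow> partial_recursive (\<lambda>xs. Some (F xs))"

text \<open>Universality (in the sense of Kolmogorov's invariance: U simulates every partial recursive
  decoder up to an additive constant in program length). Binary strings are bool lists.\<close>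
definition universal_prf :: "(bool list \<Rightarrow> 'a::finite list option) \<Rightarrow> bool" where
  "universal_prf U \<longleftrightarrow> partial_recursive U \<and>
     (\<forall>V :: bool list \<Rightarrow> 'a list option. partial_recursive V \<longrightarrow>
        (\<exists>c::nat. \<forall>q s. V q = Some s \<longrightarrow> (\<exists>p. U p = Some s \<and> length p \<le> length q + c)))"

definition I_AIC :: "(bool list \<Rightarrow> 'a::finite list option) \<Rightarrow> 'a list \<Rightarrow> nat" where
  "I_AIC U s = (LEAST n. \<exists>p. U p = Some s \<and> length p = n)"

definition prefix :: "nat \<Rightarrow> (nat \<Rightarrow> 'a) \<Rightarrow> 'a list" where
  "prefix n \<omega> = map \<omega> [0..<n]"

definition K_AIC :: "(bool list \<Rightarrow> 'a::finite list option) \<Rightarrow> (nat \<Rightarrow> 'a) \<Rightarrow> ereal" where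
  "K_AIC U \<omega> = limsup (\<lambda>n. ereal (real (I_AIC U (prefix n \<omega>)) / real n))"

definition compression_algorithm :: "('a::finite list \<Rightarrow> bool list) \<Rightarrow> bool" where
  "compression_algorithm Z \<longleftrightarrow> total_recursive Z \<and> inj Z"

definition K_Z :: "('a list \<Rightarrow> bool list) \<Rightarrow> (nat \<Rightarrow> 'a) \<Rightarrow> ereal" where
  "K_Z Z \<omega> = limsup (\<lambda>n. ereal (real (length (Z (prefix n \<omega>))) / real n))"

definition emp_freq :: "'a list \<Rightarrow> 'a list \<Rightarrow> real" where
  "emp_freq s w = real (card {i. i \<le> length s - length w \<and> take (length w) (drop i s) = w})
                  / real (length s - length w + 1)"

definition emp_entropy :: "nat \<Rightarrow> 'a::finite list \<Rightarrow> real" where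
  "emp_entropy l s = - (1 / real l) *
     (\<Sum>w \<in> {w::'a list. length w = l}. emp_freq s w * log 2 (emp_freq s w))"

definition emp_entropy_seq :: "nat \<Rightarrow> (nat \<Rightarrow> 'a::finite) \<Rightarrow> ereal" where
  "emp_entropy_seq l \<omega> = limsup (\<lambda>n. ereal (emp_entropy l (prefix n \<omega>)))"

definition emp_entropy_lim :: "(nat \<Rightarrow> 'a::finite) \<Rightarrow> ereal" where
  "emp_entropy_lim \<omega> = lim (\<lambda>l. emp_entropy_seq l \<omega>)"

definition coarsely_optimal :: "('a::finite list \<Rightarrow> bool list) \<Rightarrow> bool" where
  "coarsely_optimal Z \<longleftrightarrow> (\<forall>k\<ge>1. \<exists>f :: nat \<Rightarrow> real. f \<in> o(\<lambda>n. real n) \<and>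
      (\<forall>s. real (length (Z s)) \<le> real (length s) * emp_entropy k s + f (length s)))"

definition shift :: "(nat \<Rightarrow> 'a) \<Rightarrow> (nat \<Rightarrow> 'a)" where
  "shift \<omega> = (\<lambda>i. \<omega> (Suc i))"

definition shift_sets :: "(nat \<Rightarrow> 'a) set set" where
  "shift_sets = sets (PiM UNIV (\<lambda>_::nat. count_space (UNIV::'a set)))"

definition invariant_measure :: "('b \<Rightarrow> 'b) \<Rightarrow> 'b measure \<Rightarrow> bool" where
  "invariant_measure T M \<longleftrightarrow> (\<forall>A \<in> sets M. emeasure M (T -` A \<inter> space M) = emeasure M A)"

definition ergodic :: "('b \<Rightarrow> 'b) \<Rightarrow> 'b measure \<Rightarrow> bool" where
  "ergodic T M \<longleftrightarrow> (\<forall>A \<in> sets M. T -` A \<inter> space M = A \<longrightarrow>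
                       measure M A = 0 \<or> measure M A = 1)"

definition fin_entropy :: "'b measure \<Rightarrow> ('b \<Rightarrow> 'c) \<Rightarrow> real" where
  "fin_entropy M X = - (\<Sum>v \<in> X ` space M.
      measure M (X -` {v} \<inter> space M) * log 2 (measure M (X -` {v} \<inter> space M)))"

text \<open>A finite measurable partition is encoded by a labelling function with finitely many
  values; the refinement xi v T^-1 xi v ... v T^-(n-1) xi is the list of labels along the orbit.\<close>
definition fin_partition :: "'b measure \<Rightarrow> ('b \<Rightarrow> nat) \<Rightarrow> bool" where
  "fin_partition M \<xi> \<longleftrightarrow> \<xi> \<in> M \<rightarrow>\<^sub>M count_space UNIV \<and> finite (\<xi> ` space M)"

definition partition_entropy_rate :: "'b measure \<Rightarrow> ('b \<Rightarrow> 'b) \<Rightarrow> ('b \<Rightarrow> nat) \<Rightarrow> real" where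
  "partition_entropy_rate M T \<xi> =
     lim (\<lambda>n. fin_entropy M (\<lambda>\<omega>. map (\<lambda>i. \<xi> ((T ^^ i) \<omega>)) [0..<n]) / real n)"

definition KS_entropy :: "'b measure \<Rightarrow> ('b \<Rightarrow> 'b) \<Rightarrow> real" where
  "KS_entropy M T = (SUP \<xi> \<in> {\<xi>. fin_partition M \<xi>}. partition_entropy_rate M T \<xi>)"

end

theory Submission
  imports Defs "HOL-Real_Asymp.Real_Asymp"
begin

text \<open>Write \<open>H\<^sub>k\<close> for the entropy of the \<open>k\<close>-block distribution of the measure and \<open>h = lim H\<^sub>k / k\<close>.
  A coarse approximation of finite partitions by cylinders identifies \<open>h\<close> with the Kolmogorov-Sinai
  entropy. By Birkhoff's theorem the empirical entropies of order \<open>k\<close> converge almost surely to \<open>H\<^sub>k / k\<close>, so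
  coarse optimality gives \<open>K\<^sub>Z \<le> h\<close>. Searching for a preimage under \<open>Z\<close> is a partial recursive decoder,
  hence \<open>K\<^sub>A\<^sub>I\<^sub>C \<le> K\<^sub>Z\<close>. For the lower bound the Shannon-McMillan-Breiman theorem is not needed: since few
  strings have short programs, Gibbs' inequality bounds the mean of \<open>I\<^sub>A\<^sub>I\<^sub>C\<close> on \<open>n\<close>-blocks below by
  \<open>H\<^sub>n - O(log n)\<close>, and a bounded sequence whose upper limit is at most \<open>h\<close> almost surely and whose
  means tend to at least \<open>h\<close> has upper limit exactly \<open>h\<close> almost surely.\<close>

section \<open>Recursive functions and decoding\<close>

text \<open>The weights 2^-length of all binary strings of length at most \<open>K\<close> add up to
  \<open>K + 1\<close>, and normalising by this number costs only a logarithm, provided that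
  \<open>K\<close> is linear in the block length. Such a \<open>K\<close> comes from a second use of
  coarse optimality, at order 1; the same linear bound makes \<open>I_AIC\<close> per symbol
  bounded, as dominated convergence requires. Almost sure convergence of the information per symbol
  can be avoided because \<open>K_AIC\<close> is an upper limit: convergence in mean gives an almost
  surely convergent subsequence, which already bounds an upper limit from below. Subadditivity of
  entropy, the price of approximating a partition and the lower bound on \<open>I_AIC\<close> are
  all instances of Gibbs' inequality, with different guessed laws.\<close>

inductive_cases evalr_RZ_E: "evalr RZ xs z"
  and evalr_RS_E: "evalr RS xs z"
  and evalr_RProj_E: "evalr (RProj i) xs z"
  and evalr_RComp_E: "evalr (RComp f gs) xs z"
  and evalr_RPrec_0_E: "evalr (RPrec f g) (0 # xs) z"
  and evalr_RPrec_Suc_E: "evalr (RPrec f g) (Suc n # xs) z"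
  and evalr_RMn_E: "evalr (RMn f) xs z"

text \<open>Makes \<open>evalr\<close> a partial function, so one evaluation excludes all other
  values. For minimisation, the smaller of two different results would have to give both zero and a
  successor.\<close>

lemma evalr_det: "evalr f xs y \<Longrightarrow> evalr f xs z \<Longrightarrow> y = z"
proof (induction arbitrary: z rule: evalr.induct)
  case (ev_comp ys gs xs f y)
  from ev_comp.prems obtain ys' where ys': "length ys' = length gs"
    "\<forall>i<length gs. evalr (gs ! i) xs (ys' ! i)" "evalr f ys' z"
    by (auto elim: evalr_RComp_E)
  have "ys = ys'"
    using ev_comp.IH(1) ev_comp.hyps(1) ys' by (intro nth_equalityI) auto
  then show ?case using ev_comp.IH(2) ys' by blast
next
  case (ev_precS f g n xs r y)
  from ev_precS.prems obtain r' where "evalr (RPrec f g) (n # xs) r'" "evalr g (r' # n # xs) z"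
    by (auto elim: evalr_RPrec_Suc_E)
  then show ?case using ev_precS.IH by blast
next
  case (ev_mn f n xs)
  from ev_mn.prems have z: "evalr f (z # xs) 0" "\<forall>m<z. \<exists>y. evalr f (m # xs) (Suc y)"
    by (auto elim: evalr_RMn_E)
  show ?case
  proof (cases n z rule: linorder_cases)
    case less
    then show ?thesis using z ev_mn.IH(1) by fastforce
  next
    case greater
    then show ?thesis using z ev_mn.IH(2) by fastforce
  qed
next
  case (ev_prec0 f xs y g)
  then show ?case by (blast elim: evalr_RPrec_0_E)
qed (auto elim: evalr_RZ_E evalr_RS_E evalr_RProj_E)

text \<open>Closure properties are stated for HOL functions of a fixed arity, so that large
  \<open>recf\<close> terms never have to be written out.\<close>

definition recursive_fun :: "nat \<Rightarrow> (nat list \<Rightarrow> nat) \<Rightarrow> bool" where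
  "recursive_fun n F \<longleftrightarrow> (\<exists>f. \<forall>xs. length xs = n \<longrightarrow> evalr f xs (F xs))"

lemma recursive_fun_cong:
  assumes "recursive_fun n F" "\<And>xs. length xs = n \<Longrightarrow> F xs = G xs"
  shows "recursive_fun n G"
  using assms unfolding recursive_fun_def by metis

lemma recursive_fun_proj: "i < n \<Longrightarrow> recursive_fun n (\<lambda>xs. xs ! i)"
  unfolding recursive_fun_def by (metis ev_proj)

lemma recursive_fun_comp:
  assumes F: "recursive_fun (length Gs) F" and Gs: "\<And>G. G \<in> set Gs \<Longrightarrow> recursive_fun n G"
  shows "recursive_fun n (\<lambda>xs. F (map (\<lambda>G. G xs) Gs))"
proof -
  obtain f where f: "\<And>xs. length xs = length Gs \<Longrightarrow> evalr f xs (F xs)"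
    using F unfolding recursive_fun_def by blast
  obtain g where g: "\<And>G xs. G \<in> set Gs \<Longrightarrow> length xs = n \<Longrightarrow> evalr (g G) xs (G xs)"
    using Gs unfolding recursive_fun_def by metis
  have "evalr (RComp f (map g Gs)) xs (F (map (\<lambda>G. G xs) Gs))" if "length xs = n" for xs
    by (rule ev_comp[where ys = "map (\<lambda>G. G xs) Gs"]) (use that f g in auto)
  then show ?thesis unfolding recursive_fun_def by blast
qed

lemma recursive_fun_zero: "recursive_fun n (\<lambda>xs. 0)"
  unfolding recursive_fun_def by (metis ev_zero)

lemma recursive_fun_Suc: "recursive_fun n F \<Longrightarrow> recursive_fun n (\<lambda>xs. Suc (F xs))"
proof -
  assume F: "recursive_fun n F"
  have "recursive_fun 1 (\<lambda>xs. Suc (xs ! 0))"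
    unfolding recursive_fun_def
    by (rule exI[of _ RS]) (auto simp: length_Suc_conv intro: ev_succ)
  then show ?thesis using recursive_fun_comp[of "[F]" "\<lambda>xs. Suc (xs ! 0)" n] F by simp
qed

lemma recursive_fun_const: "recursive_fun n (\<lambda>xs. c)"
  by (induction c) (auto intro: recursive_fun_zero recursive_fun_Suc)

lemma recursive_fun_drop:
  assumes "recursive_fun n F" shows "recursive_fun (k + n) (\<lambda>xs. F (drop k xs))"
proof -
  have "recursive_fun (k + n) (\<lambda>xs. F (map (\<lambda>G. G xs) (map (\<lambda>i xs. xs ! i) [k..<k+n])))"
    by (rule recursive_fun_comp) (use assms in \<open>auto intro: recursive_fun_proj\<close>)
  then show ?thesis
    by (rule recursive_fun_cong) (auto simp: comp_def intro!: arg_cong[of _ _ F] nth_equalityI)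
qed

text \<open>In the step function, index 0 is the previous value, index 1 the counter, and the
  parameters start at index 2. \<open>RPrec\<close> recurses on its first argument, so the bound
  \<open>H\<close> is put there by composition.\<close>

lemma recursive_fun_rec:
  assumes F: "recursive_fun n F" and G: "recursive_fun (2 + n) G" and H: "recursive_fun n H"
  shows "recursive_fun n (\<lambda>xs. rec_nat (F xs) (\<lambda>m r. G (r # m # xs)) (H xs))"
proof -
  obtain f where f: "\<And>xs. length xs = n \<Longrightarrow> evalr f xs (F xs)"
    using F unfolding recursive_fun_def by blast
  obtain g where g: "\<And>xs. length xs = 2 + n \<Longrightarrow> evalr g xs (G xs)"
    using G unfolding recursive_fun_def by blast
  have "evalr (RPrec f g) (k # xs) (rec_nat (F xs) (\<lambda>m r. G (r # m # xs)) k)"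
    if "length xs = n" for k xs
    by (induction k) (use that f g in \<open>auto intro!: ev_prec0 ev_precS\<close>)
  then have R: "recursive_fun (Suc n) (\<lambda>zs. rec_nat (F (tl zs)) (\<lambda>m r. G (r # m # tl zs)) (hd zs))"
    unfolding recursive_fun_def by (intro exI[of _ "RPrec f g"]) (auto simp: length_Suc_conv)
  have "recursive_fun n (\<lambda>xs. (\<lambda>zs. rec_nat (F (tl zs)) (\<lambda>m r. G (r # m # tl zs)) (hd zs))
          (map (\<lambda>G. G xs) (H # map (\<lambda>i xs. xs ! i) [0..<n])))"
    by (rule recursive_fun_comp) (use R H in \<open>auto intro: recursive_fun_proj\<close>)
  then show ?thesis
    by (rule recursive_fun_cong) (auto simp: comp_def map_nth)
qed

lemma recursive_fun_if_zero:
  assumes "recursive_fun n H" "recursive_fun n F" "recursive_fun n G"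
  shows "recursive_fun n (\<lambda>xs. if H xs = 0 then F xs else G xs)"
proof (rule recursive_fun_cong[OF recursive_fun_rec[OF assms(2) recursive_fun_drop[OF assms(3)] assms(1)]])
  fix xs show "rec_nat (F xs) (\<lambda>m r. G (drop 2 (r # m # xs))) (H xs) = (if H xs = 0 then F xs else G xs)"
    by (cases "H xs") auto
qed

lemma recursive_fun_add:
  assumes "recursive_fun n F" "recursive_fun n G"
  shows "recursive_fun n (\<lambda>xs. F xs + G xs)"
proof -
  have eq: "rec_nat a (\<lambda>m. Suc) k = a + k" for a k by (induction k) auto
  show ?thesis
    using recursive_fun_rec[OF assms(1) recursive_fun_Suc[OF recursive_fun_proj[of 0]] assms(2)]
    by (simp add: eq)
qed

lemma recursive_fun_pred:
  assumes "recursive_fun n F" shows "recursive_fun n (\<lambda>xs. F xs - 1)"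
proof -
  have eq: "rec_nat 0 (\<lambda>m r. m) k = k - 1" for k :: nat by (cases k) auto
  show ?thesis
    using recursive_fun_rec[OF recursive_fun_zero recursive_fun_proj[of 1] assms] by (simp add: eq)
qed

lemma recursive_fun_diff:
  assumes "recursive_fun n F" "recursive_fun n G"
  shows "recursive_fun n (\<lambda>xs. F xs - G xs)"
proof -
  have eq: "rec_nat a (\<lambda>m r. r - Suc 0) k = a - k" for a k by (induction k) auto
  show ?thesis
    using recursive_fun_rec[OF assms(1) recursive_fun_pred[OF recursive_fun_proj[of 0]] assms(2)]
    by (simp add: eq)
qed

lemma recursive_fun_prod_encode:
  assumes "recursive_fun n F" "recursive_fun n G"
  shows "recursive_fun n (\<lambda>xs. prod_encode (F xs, G xs))"
proof -
  have eq: "rec_nat 0 (\<lambda>m r. r + Suc m) k = triangle k" for k by (induction k) auto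
  have T: "recursive_fun n (\<lambda>xs. triangle (H xs))" if "recursive_fun n H" for H
    using recursive_fun_rec[OF recursive_fun_zero recursive_fun_add[OF recursive_fun_proj[of 0]
      recursive_fun_Suc[OF recursive_fun_proj[of 1]]] that] eq by simp
  show ?thesis
    unfolding prod_encode_def using assms by (auto intro!: recursive_fun_add T)
qed

text \<open>A counter that is reset on reaching \<open>K\<close>; truncated subtraction turns the
  comparison into a test for zero.\<close>

lemma recursive_fun_mod:
  assumes "recursive_fun n F" "K > 0"
  shows "recursive_fun n (\<lambda>xs. F xs mod K)"
proof -
  have eq: "rec_nat 0 (\<lambda>m r. if K - Suc r = 0 then 0 else Suc r) k = k mod K" for k
  proof (induction k)
    case (Suc k)
    have "k mod K < K" using assms(2) by simp
    then show ?case using Suc by (auto simp: mod_Suc)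
  qed simp
  show ?thesis
    using recursive_fun_rec[OF recursive_fun_zero recursive_fun_if_zero[OF recursive_fun_diff[OF
      recursive_fun_const[of _ K] recursive_fun_Suc[OF recursive_fun_proj[of 0]]] recursive_fun_zero
      recursive_fun_Suc[OF recursive_fun_proj[of 0]]] assms(1)]
    by (simp add: eq cong: if_cong del: diff_is_0_eq diff_is_0_eq')
qed

lemma recursive_fun_div:
  assumes "recursive_fun n F" "K > 0"
  shows "recursive_fun n (\<lambda>xs. F xs div K)"
proof -
  have eq: "rec_nat 0 (\<lambda>m r. if Suc m mod K = 0 then Suc r else r) k = k div K" for k
    by (induction k) (auto simp: div_Suc)
  show ?thesis
    by (rule recursive_fun_cong[OF recursive_fun_rec[OF recursive_fun_zero recursive_fun_if_zero[OF
      recursive_fun_mod[OF recursive_fun_Suc[OF recursive_fun_proj[of 1]] assms(2)]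
      recursive_fun_Suc[OF recursive_fun_proj[of 0]] recursive_fun_proj[of 0]] assms(1)]])
      (simp_all add: eq[symmetric] cong: if_cong)
qed

text \<open>Not every number is the code of a string over the alphabet, and a recursive function realising \<open>Z\<close>
  need not be defined elsewhere, so an unbounded search must run through codes only. Reading a base
  \<open>K\<close> digit \<open>0\<close> of \<open>t\<close> as \<open>skip\<close> and a digit \<open>Suc x\<close> as \<open>prepend x\<close>, the diagonal \<open>i = t\<close> enumerates the
  codes of all lists over \<open>{..<K - 1}\<close>.\<close>
definition digit_list_code :: "nat \<Rightarrow> nat \<Rightarrow> nat \<Rightarrow> nat" where
  "digit_list_code K i t = rec_nat 0 (\<lambda>j r. if t div K ^ j mod K = 0 then r
     else Suc (prod_encode (t div K ^ j mod K - 1, r))) i"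

lemma digit_list_code_0 [simp]: "digit_list_code K 0 t = 0"
  and digit_list_code_Suc: "digit_list_code K (Suc i) t =
    (if t div K ^ i mod K = 0 then digit_list_code K i t
     else Suc (prod_encode (t div K ^ i mod K - 1, digit_list_code K i t)))"
  by (simp_all add: digit_list_code_def)

lemma recursive_fun_digit_list_code:
  assumes "K > 0" shows "recursive_fun 1 (\<lambda>xs. digit_list_code K (xs ! 0) (xs ! 0))"
proof -
  \<comment> \<open>Dividing \<open>j\<close> times by the constant \<open>K\<close> avoids
    exponentiation and division by a variable.\<close>
  have eq: "rec_nat t (\<lambda>m r. r div K) j = t div K ^ j" for t j
    by (induction j) (auto simp: div_mult2_eq power_Suc2 simp del: power_Suc)
  have "recursive_fun 3 (\<lambda>xs. rec_nat (xs ! 2) (\<lambda>m r. (r # m # xs) ! 0 div K) (xs ! 1))"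
    by (rule recursive_fun_rec) (auto intro!: recursive_fun_div recursive_fun_proj assms)
  then have "recursive_fun 3 (\<lambda>xs. xs ! 2 div K ^ (xs ! 1))"
    by (simp add: eq)
  then have d: "recursive_fun 3 (\<lambda>xs. xs ! 2 div K ^ (xs ! 1) mod K)"
    by (rule recursive_fun_mod[OF _ assms])
  have "recursive_fun 3 (\<lambda>xs. if xs ! 2 div K ^ (xs ! 1) mod K = 0 then xs ! 0
     else Suc (prod_encode (xs ! 2 div K ^ (xs ! 1) mod K - 1, xs ! 0)))"
    by (intro recursive_fun_if_zero recursive_fun_Suc recursive_fun_prod_encode recursive_fun_pred d
        recursive_fun_proj) auto
  then have "recursive_fun (2 + 1) (\<lambda>xs. if xs ! 2 div K ^ (xs ! 1) mod K = 0 then xs ! 0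
     else Suc (prod_encode (xs ! 2 div K ^ (xs ! 1) mod K - 1, xs ! 0)))"
    by (simp add: numeral_eq_Suc)
  from recursive_fun_rec[OF recursive_fun_zero this recursive_fun_proj[of 0]]
  show ?thesis unfolding digit_list_code_def by (simp add: numeral_2_eq_2 cong: if_cong)
qed

lemma digit_list_code_valid:
  assumes "K > 0" shows "\<exists>xs. set xs \<subseteq> {..<K - 1} \<and> digit_list_code K i t = list_encode xs"
proof (induction i)
  case 0
  show ?case by (rule exI[of _ "[]"]) simp
next
  case (Suc i)
  then obtain xs where xs: "set xs \<subseteq> {..<K - 1}" "digit_list_code K i t = list_encode xs" by blast
  have "t div K ^ i mod K < K" using assms by simp
  then have *: "t div K ^ i mod K \<noteq> 0 \<Longrightarrow> set ((t div K ^ i mod K - 1) # xs) \<subseteq> {..<K - 1}"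
    using xs(1) by auto
  show ?case
  proof (cases "t div K ^ i mod K = 0")
    case False
    show ?thesis
      by (rule exI[of _ "(t div K ^ i mod K - 1) # xs"])
         (use * xs False in \<open>simp add: digit_list_code_Suc\<close>)
  qed (use xs in \<open>auto simp: digit_list_code_Suc\<close>)
qed

text \<open>The lowest \<open>i\<close> digits depend only on the number modulo
  \<open>K ^ i\<close>, so a new top digit leaves the list built so far intact.\<close>

lemma digit_list_code_add_high:
  assumes "K > 0" shows "digit_list_code K i (t + d * K ^ i) = digit_list_code K i t"
proof -
  have "digit_list_code K j (t + d * K ^ i) = digit_list_code K j t" if "j \<le> i" for j
    using that
  proof (induction j)
    case (Suc j)
    have "d * K ^ i = (d * K ^ (i - Suc j) * K) * K ^ j"
      using Suc.prems power_add[of K "i - Suc j" "Suc j"] by (simp add: mult_ac)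
    then have "(t + d * K ^ i) div K ^ j = t div K ^ j + d * K ^ (i - Suc j) * K"
      using assms by (simp only: div_mult_self3 power_eq_0_iff) (simp add: add.commute)
    then have "(t + d * K ^ i) div K ^ j mod K = t div K ^ j mod K"
      by simp
    with Suc show ?case by (simp add: digit_list_code_Suc)
  qed simp
  then show ?thesis by simp
qed

text \<open>All digits from position \<open>i\<close> on are 0 and mean \<open>skip\<close>. Hence
  the number of digits to read need not be known, and the diagonal suffices.\<close>

lemma digit_list_code_stable:
  assumes "K > 0" "t < K ^ i" "i \<le> j" shows "digit_list_code K j t = digit_list_code K i t"
  using assms(3)
proof (induction rule: dec_induct)
  case (step n)
  have "t < K ^ n"
  proof -
    have "K ^ i \<le> K ^ n" using step.hyps(1) assms(1) by (intro power_increasing) auto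
    then show ?thesis using assms(2) by simp
  qed
  then show ?case using step.IH by (simp add: digit_list_code_Suc)
qed simp

lemma digit_list_code_surj:
  assumes K: "K > 1" and "set xs \<subseteq> {..<K - 1}"
  shows "\<exists>t. digit_list_code K t t = list_encode xs"
proof -
  have "\<exists>i t. t < K ^ i \<and> digit_list_code K i t = list_encode xs"
    using assms(2)
  proof (induction xs)
    case Nil
    show ?case by (rule exI[of _ 0]) auto
  next
    case (Cons x xs)
    then obtain i t where t: "t < K ^ i" "digit_list_code K i t = list_encode xs" by auto
    \<comment> \<open>Digits are read from the lowest upwards and each symbol is prepended, so the
      head of the list is the most significant digit.\<close>
    let ?t = "t + Suc x * K ^ i"
    have x: "Suc x < K" using Cons.prems by auto
    then have "(Suc x + 1) * K ^ i \<le> K * K ^ i" by (intro mult_right_mono) auto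
    then have "?t < K ^ Suc i" using t(1) by simp
    moreover have "?t div K ^ i mod K = Suc x" using t(1) x by (simp del: mult_Suc)
    then have "digit_list_code K (Suc i) ?t = list_encode (x # xs)"
      using K t(2) digit_list_code_add_high[of K i t "Suc x"] by (simp add: digit_list_code_Suc)
    ultimately show ?case by blast
  qed
  then obtain i t where t: "t < K ^ i" "digit_list_code K i t = list_encode xs" by blast
  have "t < K ^ t" by (rule power_gt_expt) (use K in simp)
  then have "digit_list_code K t t = digit_list_code K (max i t) t"
    using K digit_list_code_stable[of K t t "max i t"] by simp
  also have "\<dots> = digit_list_code K i t" using t(1) K digit_list_code_stable[of K t i "max i t"] by simp
  finally show ?thesis using t(2) by (intro exI[of _ t]) simp
qed

section \<open>String codes and the decoder that inverts a compressor\<close>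

lemma bij_betw_sym_index: "bij_betw (sym_index :: 'a::finite \<Rightarrow> nat) UNIV {..<CARD('a)}"
proof -
  have "\<exists>f. bij_betw f (UNIV::'a set) {..<CARD('a)}"
    using ex_bij_betw_finite_nat[of "UNIV :: 'a set"] by (simp add: atLeast0LessThan)
  then show ?thesis unfolding sym_index_def by (rule someI_ex)
qed

lemma inj_sym_index: "inj sym_index"
  using bij_betw_sym_index by (rule bij_betw_imp_inj_on)

lemma inj_str_code: "inj str_code"
  using inj_mapI[OF inj_sym_index] unfolding str_code_def inj_def list_encode_eq by blast

lemma range_str_code:
  "range (str_code :: 'a::finite list \<Rightarrow> nat) = list_encode ` {xs. set xs \<subseteq> {..<CARD('a)}}"
proof -
  have "range (map (sym_index :: 'a \<Rightarrow> nat)) = {xs. set xs \<subseteq> {..<CARD('a)}}"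
    using bij_betw_sym_index[where 'a='a] lists_image[of sym_index "UNIV :: 'a set"]
    by (auto simp: bij_betw_def lists_eq_set)
  then show ?thesis unfolding str_code_def by (metis image_image)
qed

text \<open>The decoder enumerates all strings until \<open>Z\<close> maps one of them to the input,
  and returns it. On inputs outside the range of \<open>Z\<close> the search diverges, which is the
  value \<open>None\<close>.\<close>

lemma partial_recursive_inverse:
  fixes Z :: "'a::finite list \<Rightarrow> 'b::finite list"
  assumes "total_recursive Z" "inj Z"
  shows "partial_recursive (\<lambda>q. if q \<in> range Z then Some (inv Z q) else None)"
proof -
  \<comment> \<open>One digit per symbol, plus the digit 0 for \<open>skip\<close>.\<close>
  define e where "e t = digit_list_code (CARD('a) + 1) t t" for t
  have e_range: "range e = range (str_code :: 'a list \<Rightarrow> nat)"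
  proof -
    have "\<exists>xs. set xs \<subseteq> {..<CARD('a)} \<and> e t = list_encode xs" for t
      using digit_list_code_valid[of "CARD('a) + 1" t t] unfolding e_def by simp
    moreover have "\<exists>t. e t = list_encode xs" if "set xs \<subseteq> {..<CARD('a)}" for xs
      using digit_list_code_surj[of "CARD('a) + 1" xs] that unfolding e_def by simp
    ultimately show ?thesis
      unfolding range_str_code by (auto simp: image_iff) metis+
  qed
  obtain g f where f: "\<And>x y. evalr f [x] y \<longleftrightarrow> g x = Some y"
    and g: "\<And>xs. g (str_code xs) = Some (str_code (Z xs))"
    using assms(1) unfolding total_recursive_def partial_recursive_def partrec_nat_def by auto
  define s :: "nat \<Rightarrow> 'a list" where "s t = (SOME s. e t = str_code s)" for t
  have s: "e t = str_code (s t)" for t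
    unfolding s_def by (rule someI_ex) (use e_range in blast)
  obtain E where E: "\<And>t. evalr E [t] (e t)"
    using recursive_fun_digit_list_code[of "CARD('a) + 1"] unfolding recursive_fun_def e_def
    by (fastforce dest: spec[of _ "[_]"])
  have gE: "evalr (RComp f [E]) [t] (str_code (Z (s t)))" for t
    by (rule ev_comp[where ys = "[e t]"]) (use E f g s in auto)
  have "recursive_fun 1 (\<lambda>xs. str_code (Z (s (xs ! 0))))"
    unfolding recursive_fun_def by (rule exI[of _ "RComp f [E]"]) (use gE in \<open>auto simp: length_Suc_conv\<close>)
  then have "recursive_fun 2 (\<lambda>xs. str_code (Z (s (map (\<lambda>G. G xs) [\<lambda>xs. xs ! 0] ! 0))))"
    by (intro recursive_fun_comp[of "[\<lambda>xs. xs ! 0]"]) (auto intro: recursive_fun_proj)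
  then have "recursive_fun 2 (\<lambda>xs. str_code (Z (s (xs ! 0))))" by simp
  \<comment> \<open>The sum of both truncated differences is 0 exactly if the two numbers agree, so
    the search for a preimage becomes a search for a zero.\<close>
  then have "recursive_fun 2 (\<lambda>xs. (str_code (Z (s (xs ! 0))) - xs ! 1) + (xs ! 1 - str_code (Z (s (xs ! 0)))))"
    by (intro recursive_fun_add recursive_fun_diff recursive_fun_proj) auto
  then obtain h where h: "\<And>t y. evalr h [t, y] ((str_code (Z (s t)) - y) + (y - str_code (Z (s t))))"
    unfolding recursive_fun_def by (fastforce dest: spec[of _ "[_, _]"])
  define r where "r = RComp E [RMn h]"
  have mn: "evalr (RMn h) [y] t \<Longrightarrow> str_code (Z (s t)) = y" for y t
    by (auto elim!: evalr_RMn_E dest: evalr_det[OF h])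
  have r_range: "evalr r [str_code q] (str_code (inv Z q))" if q: "q \<in> range Z" for q
  proof -
    obtain t0 where "e t0 = str_code (inv Z q)" using e_range by (metis rangeE rangeI)
    then have "s t0 = inv Z q" using s inj_str_code by (metis injD)
    then have ex: "str_code (Z (s t0)) = str_code q" using q by (simp add: f_inv_into_f)
    define t where "t = (LEAST t. str_code (Z (s t)) = str_code q)"
    have t: "str_code (Z (s t)) = str_code q" unfolding t_def using ex by (rule LeastI)
    have "\<exists>y. evalr h [m, str_code q] (Suc y)" if "m < t" for m
    proof -
      have "str_code (Z (s m)) \<noteq> str_code q" using that not_less_Least unfolding t_def by blast
      then have "(str_code (Z (s m)) - str_code q) + (str_code q - str_code (Z (s m))) \<noteq> 0" by auto
      then show ?thesis using h[of m "str_code q"] by (metis not0_implies_Suc)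
    qed
    moreover have "evalr h [t, str_code q] 0" using h[of t "str_code q"] t by simp
    ultimately have "evalr (RMn h) [str_code q] t" by (auto intro: ev_mn)
    then have "evalr r [str_code q] (e t)"
      unfolding r_def by (intro ev_comp[where ys = "[t]"]) (use E in auto)
    moreover have "s t = inv Z q"
      using inv_f_f[OF assms(2)] injD[OF inj_str_code t] by metis
    ultimately show ?thesis using s by simp
  qed
  have r_none: "\<not> evalr r [str_code q] y" if q: "q \<notin> range Z" for q y
  proof
    assume "evalr r [str_code q] y"
    then obtain t where "evalr (RMn h) [str_code q] t"
      unfolding r_def by (fastforce elim!: evalr_RComp_E simp: length_Suc_conv)
    then show False using injD[OF inj_str_code mn] q by blast
  qed
  \<comment> \<open>\<open>r\<close> may also halt on numbers that code no string.
    \<open>partial_recursive\<close> constrains \<open>G\<close> at codes only, so \<open>G\<close>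
    can be everything that \<open>r\<close> computes.\<close>
  define G where "G x = (if \<exists>y. evalr r [x] y then Some (THE y. evalr r [x] y) else None)" for x
  have G: "evalr r [x] y \<longleftrightarrow> G x = Some y" for x y
  proof -
    have "(THE y. evalr r [x] y) = y0" if "evalr r [x] y0" for y0
      using that evalr_det[of r "[x]"] by (intro the_equality) blast+
    then show ?thesis unfolding G_def by auto
  qed
  have "partrec_nat G" unfolding partrec_nat_def using G by blast
  moreover have "G (str_code q) = map_option str_code (if q \<in> range Z then Some (inv Z q) else None)" for q
  proof (cases "q \<in> range Z")
    case True
    then show ?thesis using r_range G by simp
  next
    case False
    then have "G (str_code q) \<noteq> Some y" for y using r_none G by blast
    then show ?thesis using False by (cases "G (str_code q)") auto
  qed
  ultimately show ?thesis unfolding partial_recursive_def by blast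
qed

lemma I_AIC_witness:
  assumes "U p = Some s" shows "\<exists>p. U p = Some s \<and> length p = I_AIC U s"
  unfolding I_AIC_def by (rule LeastI_ex[of "\<lambda>n. \<exists>p. U p = Some s \<and> length p = n"]) (use assms in blast)

lemma I_AIC_le: "U p = Some s \<Longrightarrow> I_AIC U s \<le> length p"
  unfolding I_AIC_def by (rule Least_le) blast

text \<open>With the inverse of \<open>Z\<close> as decoder, \<open>Z s\<close> is a program for
  \<open>s\<close>, and universality translates it at constant cost. The existence of a program is
  recorded as well, because \<open>LEAST\<close> says nothing about an empty set.\<close>

lemma I_AIC_compression:
  assumes "universal_prf U" "compression_algorithm Z"
  shows "\<exists>c. \<forall>s. (\<exists>p. U p = Some s) \<and> I_AIC U s \<le> length (Z s) + c"
proof -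
  have "inj Z" using assms(2) unfolding compression_algorithm_def by blast
  define V where "V q = (if q \<in> range Z then Some (inv Z q) else None)" for q
  have "partial_recursive V"
    using partial_recursive_inverse[of Z] assms(2)
    unfolding compression_algorithm_def V_def[abs_def] by blast
  then have "\<exists>c. \<forall>q s. V q = Some s \<longrightarrow> (\<exists>p. U p = Some s \<and> length p \<le> length q + c)"
    using assms(1) unfolding universal_prf_def by blast
  then obtain c where c: "\<And>q s. V q = Some s \<Longrightarrow> \<exists>p. U p = Some s \<and> length p \<le> length q + c"
    by blast
  have "\<exists>p. U p = Some s \<and> length p \<le> length (Z s) + c" for s
    by (rule c) (simp add: \<open>inj Z\<close> V_def)
  then have "(\<exists>p. U p = Some s) \<and> I_AIC U s \<le> length (Z s) + c" for s
    using I_AIC_le[of U _ s] order_trans by blast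
  then show ?thesis by blast
qed

section \<open>Birkhoff's ergodic theorem\<close>

definition birkhoff_sum :: "('b \<Rightarrow> 'b) \<Rightarrow> ('b \<Rightarrow> real) \<Rightarrow> nat \<Rightarrow> 'b \<Rightarrow> real" where
  "birkhoff_sum T f n x = (\<Sum>i<n. f ((T ^^ i) x))"

lemma birkhoff_sum_0 [simp]: "birkhoff_sum T f 0 x = 0"
  by (simp add: birkhoff_sum_def)

lemma birkhoff_sum_Suc: "birkhoff_sum T f (Suc n) x = f x + birkhoff_sum T f n (T x)"
  by (simp add: birkhoff_sum_def sum.lessThan_Suc_shift funpow_swap1 del: sum.lessThan_Suc)

text \<open>The recursion unfolds to the maximum of the Birkhoff sums of length \<open>0, \<dots>, n\<close>.\<close>
primrec max_birkhoff_sum :: "('b \<Rightarrow> 'b) \<Rightarrow> ('b \<Rightarrow> real) \<Rightarrow> nat \<Rightarrow> 'b \<Rightarrow> real" where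
  "max_birkhoff_sum T f 0 = (\<lambda>x. 0)"
| "max_birkhoff_sum T f (Suc n) = (\<lambda>x. max 0 (f x + max_birkhoff_sum T f n (T x)))"

lemma max_birkhoff_sum_nonneg: "max_birkhoff_sum T f n x \<ge> 0"
  by (cases n) auto

lemma max_birkhoff_sum_mono: "max_birkhoff_sum T f n x \<le> max_birkhoff_sum T f (Suc n) x"
proof (induction n arbitrary: x)
  case (Suc n)
  show ?case using Suc[of "T x"] by simp
qed simp

lemma incseq_max_birkhoff_sum: "incseq (\<lambda>n. max_birkhoff_sum T f n x)"
  by (rule incseq_SucI) (rule max_birkhoff_sum_mono)

lemma birkhoff_sum_le_max: "birkhoff_sum T f n x \<le> max_birkhoff_sum T f n x"
proof (induction n arbitrary: x)
  case (Suc n)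
  show ?case using Suc[of "T x"] by (simp add: birkhoff_sum_Suc)
qed simp

lemma max_birkhoff_sum_bounded:
  assumes "\<And>x. \<bar>f x\<bar> \<le> B"
  shows "max_birkhoff_sum T f n x \<le> real n * B"
proof (induction n arbitrary: x)
  case (Suc n)
  have "B \<ge> 0" using assms[of x] by linarith
  then show ?case using Suc[of "T x"] assms[of x] by (simp add: algebra_simps abs_le_iff)
qed simp

text \<open>Where the maximum is positive, it is \<open>f x\<close> plus a shorter maximum at
  \<open>T x\<close>, which the full maximum there dominates. Elsewhere it is 0 and the subtracted
  term is nonnegative.\<close>

lemma max_birkhoff_sum_diff:
  "max_birkhoff_sum T f n x - max_birkhoff_sum T f n (T x)
     \<le> f x * indicator {x. max_birkhoff_sum T f n x > 0} x"
proof (cases n)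
  case (Suc m)
  show ?thesis
  proof (cases "max_birkhoff_sum T f n x > 0")
    case True
    then have "max_birkhoff_sum T f n x = f x + max_birkhoff_sum T f m (T x)" using Suc by auto
    also have "\<dots> \<le> f x + max_birkhoff_sum T f n (T x)"
      using max_birkhoff_sum_mono[of T f m "T x"] Suc by simp
    finally show ?thesis using True by simp
  next
    case False
    then show ?thesis
      using max_birkhoff_sum_nonneg[of T f n x] max_birkhoff_sum_nonneg[of T f n "T x"] by simp
  qed
qed simp

locale measure_preserving_system = prob_space M for M :: "'b measure" +
  fixes T :: "'b \<Rightarrow> 'b"
  assumes T_measurable [measurable]: "T \<in> M \<rightarrow>\<^sub>M M"
    and distr_T: "distr M M T = M"
begin

lemma funpow_T_measurable [measurable]: "(T ^^ n) \<in> M \<rightarrow>\<^sub>M M"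
  by (induction n) (auto simp: id_def comp_def intro: measurable_compose)

lemma distr_funpow_T: "distr M M (T ^^ n) = M"
proof (induction n)
  case (Suc n)
  have "distr M M (T ^^ Suc n) = distr (distr M M (T ^^ n)) M T"
    by (simp add: distr_distr)
  then show ?case by (simp only: Suc distr_T)
qed (simp add: id_def distr_id)

lemma integral_funpow_T:
  fixes f :: "'b \<Rightarrow> real"
  assumes "f \<in> borel_measurable M"
  shows "(\<integral>x. f ((T ^^ n) x) \<partial>M) = (\<integral>x. f x \<partial>M)"
  using integral_distr[OF funpow_T_measurable assms, of n] by (simp add: distr_funpow_T)

lemma birkhoff_sum_measurable [measurable]:
  assumes [measurable]: "f \<in> borel_measurable M"
  shows "birkhoff_sum T f n \<in> borel_measurable M"
proof -
  have "(\<lambda>x. f ((T ^^ i) x)) \<in> borel_measurable M" for i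
    by (rule measurable_compose[OF funpow_T_measurable assms])
  then show ?thesis unfolding birkhoff_sum_def[abs_def] by simp
qed

lemma max_birkhoff_sum_measurable [measurable]:
  assumes [measurable]: "f \<in> borel_measurable M"
  shows "max_birkhoff_sum T f n \<in> borel_measurable M"
proof (induction n)
  case (Suc n)
  note [measurable] = Suc
  show ?case by simp
qed simp

lemma bounded_integrable:
  fixes f :: "'b \<Rightarrow> real"
  assumes "f \<in> borel_measurable M" "\<And>x. \<bar>f x\<bar> \<le> B"
  shows "integrable M f"
  by (rule integrable_const_bound[of _ B]) (use assms in auto)

text \<open>Garsia's argument: where the running maximum is positive, \<open>f\<close> dominates its decrease along \<open>T\<close>, and
  that decrease has mean zero by invariance.\<close>
lemma maximal_ergodic:
  assumes f [measurable]: "f \<in> borel_measurable M" and B: "\<And>x. \<bar>f x\<bar> \<le> B"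
    and pos: "AE x in M. \<exists>n. birkhoff_sum T f n x > 0"
  shows "(\<integral>x. f x \<partial>M) \<ge> 0"
proof -
  define E where "E n = {x. max_birkhoff_sum T f n x > 0}" for n
  have int_max: "integrable M (max_birkhoff_sum T f n)" for n
    using max_birkhoff_sum_bounded[of f B T n, OF B] max_birkhoff_sum_nonneg[of T f n]
    by (intro bounded_integrable[of _ "real n * B"]) (auto simp: abs_le_iff intro: order_trans[of _ 0])
  have [measurable]: "Measurable.pred M (\<lambda>x. x \<in> E n)" for n
    unfolding E_def by measurable
  have int_ind: "integrable M (\<lambda>x. f x * indicator (E n) x)" for n
  proof (rule bounded_integrable[of _ B])
    show "\<bar>f x * indicator (E n) x\<bar> \<le> B" for x
      using B[of x] by (auto simp: indicator_def)
  qed (simp add: indicator_def)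
  have ge0: "(\<integral>x. f x * indicator (E n) x \<partial>M) \<ge> 0" for n
  proof -
    have int_T: "integrable M (\<lambda>x. max_birkhoff_sum T f n (T x))"
      using integrable_distr[OF T_measurable, of "max_birkhoff_sum T f n"] int_max by (simp add: distr_T)
    have "0 = (\<integral>x. max_birkhoff_sum T f n x - max_birkhoff_sum T f n (T x) \<partial>M)"
      using integral_funpow_T[of "max_birkhoff_sum T f n" 1] int_max int_T by simp
    also have "\<dots> \<le> (\<integral>x. f x * indicator (E n) x \<partial>M)"
      using max_birkhoff_sum_diff[of T f n] int_max int_T int_ind unfolding E_def
      by (intro integral_mono) auto
    finally show ?thesis .
  qed
  \<comment> \<open>By \<open>pos\<close>, almost every point lies in all \<open>E n\<close> from
    some \<open>n\<close> on, so the integrals over \<open>E n\<close> exhaust the full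
    integral.\<close>
  have "(\<lambda>n. \<integral>x. f x * indicator (E n) x \<partial>M) \<longlonglongrightarrow> (\<integral>x. f x \<partial>M)"
  proof (rule integral_dominated_convergence[where w = "\<lambda>x. B"])
    show "AE x in M. (\<lambda>n. f x * indicator (E n) x) \<longlonglongrightarrow> f x"
      using pos
    proof eventually_elim
      case (elim x)
      then obtain k where k: "birkhoff_sum T f k x > 0" by blast
      have "x \<in> E n" if "n \<ge> k" for n
        using k birkhoff_sum_le_max[of T f k x] incseqD[OF incseq_max_birkhoff_sum that, of T f x]
        unfolding E_def by simp
      then have "eventually (\<lambda>n. f x * indicator (E n) x = f x) sequentially"
        by (intro eventually_sequentiallyI[of k]) simp
      then show ?case by (rule tendsto_eventually)
    qed
    show "AE x in M. norm (f x * indicator (E n) x) \<le> B" for n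
      using B by (auto simp: indicator_def intro!: AE_I2 order_trans[OF abs_ge_zero B])
  qed (auto simp: indicator_def)
  then show ?thesis by (rule LIMSEQ_le_const) (use ge0 in auto)
qed

text \<open>If \<open>L\<close> exceeded \<open>c\<close>, the mean plus \<open>e\<close>, with
  positive probability, it would do so almost everywhere by ergodicity. Some Birkhoff sum of
  \<open>f - c\<close> would then be positive at almost every point, and the maximal inequality
  would push the mean of \<open>f\<close> up to \<open>c\<close>. \<open>L\<close> is shown
  invariant at every point because \<open>ergodic\<close> speaks of strictly invariant sets.\<close>

lemma birkhoff_upper:
  assumes f [measurable]: "f \<in> borel_measurable M" and B: "\<And>x. \<bar>f x\<bar> \<le> B"
    and erg: "ergodic T M"
  shows "AE x in M. limsup (\<lambda>n. ereal (birkhoff_sum T f n x / real n)) \<le> ereal (\<integral>x. f x \<partial>M)"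
proof -
  define L where "L x = limsup (\<lambda>n. ereal (birkhoff_sum T f n x / real n))" for x
  have [measurable]: "L \<in> borel_measurable M"
    unfolding L_def[abs_def] by measurable
  have L_T: "L (T x) = L x" for x
  proof -
    define d where "d n = (f ((T ^^ n) x) - f x) / real n" for n
    have "birkhoff_sum T f n (T x) = birkhoff_sum T f n x + (f ((T ^^ n) x) - f x)" for n
      using birkhoff_sum_Suc[of T f n x] by (simp add: birkhoff_sum_def)
    then have eq: "ereal (birkhoff_sum T f n (T x) / real n)
        = ereal (d n) + ereal (birkhoff_sum T f n x / real n)" for n
      by (simp add: d_def add_divide_distrib add.commute)
    have "d \<longlonglongrightarrow> 0"
    proof (rule Lim_null_comparison)
      have "\<bar>f ((T ^^ n) x) - f x\<bar> \<le> 2 * B" for n using B[of "(T ^^ n) x"] B[of x] by linarith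
      then have "norm (d n) \<le> 2 * B / real n" for n
        unfolding d_def by (simp add: divide_right_mono)
      then show "eventually (\<lambda>n. norm (d n) \<le> 2 * B / real n) sequentially" by simp
      show "(\<lambda>n. 2 * B / real n) \<longlonglongrightarrow> 0" by (rule lim_const_over_n)
    qed
    then have "(\<lambda>n. ereal (d n)) \<longlonglongrightarrow> 0" by (simp add: zero_ereal_def)
    then show ?thesis
      unfolding L_def eq using ereal_limsup_lim_add[of "\<lambda>n. ereal (d n)" 0] by (simp del: plus_ereal.simps)
  qed
  have le: "AE x in M. L x \<le> ereal ((\<integral>x. f x \<partial>M) + e)" if e: "e > 0" for e
  proof -
    define c where "c = (\<integral>x. f x \<partial>M) + e"
    define A where "A = {x \<in> space M. L x > ereal c}"
    have A [measurable]: "A \<in> sets M" unfolding A_def by measurable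
    have "T -` A \<inter> space M = A"
      unfolding A_def using L_T measurable_space[OF T_measurable] by auto
    then consider "prob A = 0" | "prob A = 1" using erg A unfolding ergodic_def by blast
    then have "prob A = 0"
    proof cases
      case 2
      then have "AE x in M. x \<in> A" using A by (simp add: prob_eq_1)
      then have "AE x in M. \<exists>n. birkhoff_sum T (\<lambda>x. f x - c) n x > 0"
      proof eventually_elim
        case (elim x)
        show ?case
        proof (rule ccontr)
          assume neg: "\<not> ?thesis"
          have "birkhoff_sum T f n x / real n \<le> c" if "n \<ge> 1" for n
          proof -
            have "birkhoff_sum T (\<lambda>x. f x - c) n x = birkhoff_sum T f n x - real n * c"
              by (simp add: birkhoff_sum_def sum_subtractf)
            moreover have "birkhoff_sum T (\<lambda>x. f x - c) n x \<le> 0" using neg by (simp add: not_less)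
            ultimately show ?thesis using that by (simp add: divide_simps mult.commute)
          qed
          then have "L x \<le> ereal c"
            unfolding L_def by (intro Limsup_bounded eventually_sequentiallyI[of 1]) simp
          then show False using elim unfolding A_def by (simp add: leD)
        qed
      qed
      moreover have "\<bar>f x - c\<bar> \<le> B + \<bar>c\<bar>" for x using B[of x] by linarith
      ultimately have "(\<integral>x. f x - c \<partial>M) \<ge> 0" by (intro maximal_ergodic[of _ "B + \<bar>c\<bar>"]) auto
      moreover have "integrable M f" using f B by (rule bounded_integrable)
      ultimately have "(\<integral>x. f x \<partial>M) - c \<ge> 0" by (simp add: prob_space)
      then show ?thesis using e unfolding c_def by simp
    qed
    then have "AE x in M. x \<notin> A" using A by (simp add: prob_eq_0)
    then show ?thesis unfolding A_def c_def by (auto simp: not_less)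
  qed
  have "AE x in M. \<forall>m. L x \<le> ereal ((\<integral>x. f x \<partial>M) + 1 / real (Suc m))"
    unfolding AE_all_countable by (intro allI le) simp
  then show ?thesis
  proof eventually_elim
    case (elim x)
    have "(\<lambda>m. ereal ((\<integral>x. f x \<partial>M) + 1 / real (Suc m))) \<longlonglongrightarrow> ereal ((\<integral>x. f x \<partial>M) + 0)"
      using LIMSEQ_inverse_real_of_nat by (intro tendsto_ereal tendsto_add tendsto_const) (simp add: inverse_eq_divide)
    from LIMSEQ_le_const[OF this, of "L x"] elim show ?case unfolding L_def by simp
  qed
qed

theorem birkhoff_ergodic:
  assumes f [measurable]: "f \<in> borel_measurable M" and B: "\<And>x. \<bar>f x\<bar> \<le> B"
    and erg: "ergodic T M"
  shows "AE x in M. (\<lambda>n. birkhoff_sum T f n x / real n) \<longlonglongrightarrow> (\<integral>x. f x \<partial>M)"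
proof -
  have "AE x in M. limsup (\<lambda>n. ereal (birkhoff_sum T (\<lambda>x. - f x) n x / real n))
      \<le> ereal (\<integral>x. - f x \<partial>M)"
    using B erg by (intro birkhoff_upper[of _ B]) auto
  with birkhoff_upper[OF f B erg] show ?thesis
  proof eventually_elim
    case (elim x)
    let ?a = "\<lambda>n. ereal (birkhoff_sum T f n x / real n)"
    have "birkhoff_sum T (\<lambda>x. - f x) n x / real n = - (birkhoff_sum T f n x / real n)" for n
      by (simp add: birkhoff_sum_def sum_negf)
    then have "- liminf ?a \<le> - ereal (\<integral>x. f x \<partial>M)"
      using elim(2) ereal_Limsup_uminus[of sequentially ?a] by simp
    then have "ereal (\<integral>x. f x \<partial>M) \<le> liminf ?a" by (simp only: ereal_minus_le_minus)
    with elim(1) show ?case by (intro limsup_le_liminf_real)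
  qed
qed

end

section \<open>Entropy of finite-valued random variables\<close>

text \<open>Take \<open>m\<close> with nearly optimal ratio and divide \<open>n\<close> by
  \<open>m\<close>: the quotient contributes at most the ratio at \<open>m\<close>, the remainder a
  bounded amount.\<close>

lemma fekete:
  fixes a :: "nat \<Rightarrow> real"
  assumes sub: "\<And>m n. a (m + n) \<le> a m + a n" and nonneg: "\<And>n. a n \<ge> 0"
  shows "(\<lambda>n. a n / real n) \<longlonglongrightarrow> (INF n\<in>{1..}. a n / real n)"
proof -
  define L where "L = (INF n\<in>{1..}. a n / real n)"
  have bdd: "bdd_below ((\<lambda>n. a n / real n) ` {1..})"
    by (rule bdd_belowI2[of _ 0]) (simp add: nonneg)
  have lower: "L \<le> a n / real n" if "n \<ge> 1" for n
    unfolding L_def using bdd that by (intro cINF_lower) auto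
  have mult: "a (q * m + r) \<le> real q * a m + a r" for q m r
  proof (induction q)
    case (Suc q)
    then show ?case using sub[of m "q * m + r"] by (simp add: algebra_simps)
  qed simp
  show ?thesis
    unfolding L_def[symmetric]
  proof (rule LIMSEQ_I)
    fix e :: real assume "e > 0"
    have "\<exists>m\<in>{1..}. a m / real m < L + e / 2"
      using cINF_less_iff[OF _ bdd, of "L + e / 2"] \<open>e > 0\<close> unfolding L_def by auto
    then obtain m where m: "m \<ge> 1" "a m / real m < L + e / 2" by auto
    \<comment> \<open>A bound for all remainders at once, since the terms are nonnegative.\<close>
    define C where "C = (\<Sum>r<m. a r)"
    have C: "a r \<le> C" if "r < m" for r
      unfolding C_def using that nonneg by (intro member_le_sum) auto
    have upper: "a n / real n \<le> a m / real m + C / real n" if "n \<ge> 1" for n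
    proof -
      have "a n \<le> real (n div m) * a m + a (n mod m)"
        using mult[of "n div m" m "n mod m"] by simp
      also have "real (n div m) * a m \<le> (real n / real m) * a m"
        using nonneg of_nat_div_le_of_nat[of n m, where 'a = real] by (intro mult_right_mono) auto
      also have "a (n mod m) \<le> C" using C m(1) by simp
      finally show ?thesis using that by (simp add: field_simps)
    qed
    have "(\<lambda>n. C / real n) \<longlonglongrightarrow> 0" by (rule lim_const_over_n)
    then have "eventually (\<lambda>n. C / real n < e / 2) sequentially"
      using \<open>e > 0\<close> by (intro order_tendstoD) auto
    then obtain N where N: "\<And>n. n \<ge> N \<Longrightarrow> C / real n < e / 2"
      unfolding eventually_sequentially by blast
    have "norm (a n / real n - L) < e" if "n \<ge> max N 1" for n
    proof -
      have "n \<ge> N" "n \<ge> 1" using that by simp_all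
      then show ?thesis
        using N[of n] upper[of n] lower[of n] m(2) \<open>e > 0\<close>
        unfolding real_norm_def abs_less_iff by linarith
    qed
    then show "\<exists>N. \<forall>n\<ge>N. norm (a n / real n - L) < e" by blast
  qed
qed

section \<open>Laws, Gibbs' inequality and joint entropy\<close>

context prob_space begin

definition finite_rv :: "('a \<Rightarrow> 'c) \<Rightarrow> bool" where
  "finite_rv X \<longleftrightarrow> X \<in> M \<rightarrow>\<^sub>M count_space UNIV \<and> finite (X ` space M)"

definition law :: "('a \<Rightarrow> 'c) \<Rightarrow> 'c \<Rightarrow> real" where
  "law X v = prob (X -` {v} \<inter> space M)"

lemma finite_rv_measurable [measurable_dest]: "finite_rv X \<Longrightarrow> X \<in> M \<rightarrow>\<^sub>M count_space UNIV"
  and finite_rv_finite: "finite_rv X \<Longrightarrow> finite (X ` space M)"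
  by (auto simp: finite_rv_def)

lemma finite_rv_sets: "finite_rv X \<Longrightarrow> X -` A \<inter> space M \<in> sets M"
  by (rule measurable_sets[OF finite_rv_measurable]) auto

lemma finite_rv_comp: "finite_rv X \<Longrightarrow> finite_rv (\<lambda>x. f (X x))"
proof -
  assume X: "finite_rv X"
  have "(\<lambda>x. f (X x)) ` space M = f ` X ` space M" by auto
  moreover have "(\<lambda>x. f (X x)) \<in> M \<rightarrow>\<^sub>M count_space UNIV"
    by (rule measurable_compose[OF finite_rv_measurable[OF X]]) simp
  ultimately show ?thesis using X unfolding finite_rv_def by simp
qed

text \<open>For large value types, rectangles need not generate the discrete sigma-algebra on pairs;
  the finite ranges reduce each preimage to a finite union of rectangles.\<close>

lemma finite_rv_Pair:
  assumes X: "finite_rv X" and Y: "finite_rv Y"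
  shows "finite_rv (\<lambda>x. (X x, Y x))"
proof -
  have sub: "(\<lambda>x. (X x, Y x)) ` space M \<subseteq> X ` space M \<times> Y ` space M" by auto
  then have fin: "finite ((\<lambda>x. (X x, Y x)) ` space M)"
    using finite_rv_finite[OF X] finite_rv_finite[OF Y] by (meson finite_SigmaI finite_subset)
  have "(\<lambda>x. (X x, Y x)) -` A \<inter> space M \<in> sets M" for A
  proof -
    have "(\<lambda>x. (X x, Y x)) -` A \<inter> space M
       = (\<Union>(u, v)\<in>A \<inter> (X ` space M \<times> Y ` space M). (X -` {u} \<inter> space M) \<inter> (Y -` {v} \<inter> space M))"
      by auto
    also have "\<dots> \<in> sets M"
      using finite_rv_finite[OF X] finite_rv_finite[OF Y] finite_rv_sets[OF X] finite_rv_sets[OF Y]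
      by (intro sets.finite_UN) auto
    finally show ?thesis .
  qed
  then show ?thesis using fin unfolding finite_rv_def measurable_def by auto
qed

lemma law_nonneg: "law X v \<ge> 0"
  by (simp add: law_def)

lemma expectation_finite_rv:
  fixes g :: "'c \<Rightarrow> real"
  assumes X: "finite_rv X"
  shows "expectation (\<lambda>x. g (X x)) = (\<Sum>v\<in>X ` space M. law X v * g v)"
    and "integrable M (\<lambda>x. g (X x))"
proof -
  let ?s = "\<lambda>x. \<Sum>v\<in>X ` space M. indicator (X -` {v} \<inter> space M) x * g v"
  have eq: "g (X x) = ?s x" if "x \<in> space M" for x
    using that finite_rv_finite[OF X] by (simp add: indicator_def sum.delta' if_distrib cong: if_cong)
  have int: "integrable M (\<lambda>x. indicator (X -` {v} \<inter> space M) x * g v)" for v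
    using finite_rv_sets[OF X] by (intro integrable_mult_left) (auto simp: emeasure_eq_measure)
  show "integrable M (\<lambda>x. g (X x))"
    using Bochner_Integration.integrable_sum[of "X ` space M", OF int]
    by (rule Bochner_Integration.integrable_cong[THEN iffD1, rotated 2]) (auto simp: eq)
  have "expectation (\<lambda>x. g (X x)) = expectation ?s"
    using eq by (intro Bochner_Integration.integral_cong) auto
  also have "\<dots> = (\<Sum>v\<in>X ` space M. law X v * g v)"
    using int finite_rv_sets[OF X] by (simp add: Bochner_Integration.integral_sum law_def)
  finally show "expectation (\<lambda>x. g (X x)) = (\<Sum>v\<in>X ` space M. law X v * g v)" .
qed

lemma law_sum: "finite_rv X \<Longrightarrow> (\<Sum>v\<in>X ` space M. law X v) = 1"
  using expectation_finite_rv(1)[of X "\<lambda>_. 1"] by (simp add: prob_space)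

lemma fin_entropy_law: "fin_entropy M X = (\<Sum>v\<in>X ` space M. law X v * - log 2 (law X v))"
  by (simp add: fin_entropy_def law_def sum_negf)

lemma fin_entropy_eq_expectation:
  "finite_rv X \<Longrightarrow> fin_entropy M X = expectation (\<lambda>x. - log 2 (law X (X x)))"
  by (simp only: expectation_finite_rv(1)[of X "\<lambda>v. - log 2 (law X v)"] fin_entropy_law)

lemma AE_law_pos: "finite_rv X \<Longrightarrow> AE x in M. law X (X x) > 0"
proof -
  assume X: "finite_rv X"
  have "AE x in M. \<forall>v\<in>X ` space M. law X v = 0 \<longrightarrow> X x \<noteq> v"
  proof (rule AE_finite_allI[OF finite_rv_finite[OF X]])
    fix v
    show "AE x in M. law X v = 0 \<longrightarrow> X x \<noteq> v"
    proof (cases "law X v = 0")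
      case True
      then have "AE x in M. x \<notin> X -` {v} \<inter> space M"
        using finite_rv_sets[OF X] unfolding law_def by (subst prob_eq_0[symmetric]) auto
      then show ?thesis by (auto intro: AE_mp[OF _ AE_I2])
    qed simp
  qed
  then show "AE x in M. law X (X x) > 0"
    by (rule AE_mp) (use law_nonneg[of X] in \<open>auto simp: less_le intro!: AE_I2\<close>)
qed

lemma AE_finite_rvD:
  assumes X: "finite_rv X" and P: "AE x in M. P (X x)" and "law X v > 0"
  shows "P v"
proof (rule ccontr)
  assume neg: "\<not> P v"
  from P have "AE x in M. x \<notin> X -` {v} \<inter> space M" by eventually_elim (use neg in auto)
  then have "law X v = 0" unfolding law_def using finite_rv_sets[OF X] by (subst prob_eq_0) auto
  then show False using assms(3) by simp
qed

text \<open>Termwise this is \<open>ln x\<close> \<le> \<open>x - 1\<close> at the ratio of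
  \<open>Q\<close> to the law. Positivity almost everywhere matters: the logarithm of 0 is a finite
  number in HOL, so a zero weight would escape its infinite penalty.\<close>

lemma gibbs_inequality:
  assumes X: "finite_rv X" and Q: "\<And>v. v \<in> X ` space M \<Longrightarrow> Q v \<ge> 0"
    and sum: "(\<Sum>v\<in>X ` space M. Q v) \<le> 1" and pos: "AE x in M. Q (X x) > 0"
  shows "fin_entropy M X \<le> expectation (\<lambda>x. - log 2 (Q (X x)))"
proof -
  have "law X v * - log 2 (law X v) - law X v * - log 2 (Q v) \<le> (Q v - law X v) / ln 2"
    if v: "v \<in> X ` space M" for v
  proof (cases "law X v = 0")
    case True
    then show ?thesis using Q[OF v] by simp
  next
    case False
    then have p: "law X v > 0" using law_nonneg[of X v] by simp
    then have q: "Q v > 0" using AE_finite_rvD[OF X pos] by blast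
    have "ln (Q v / law X v) \<le> Q v / law X v - 1" using p q by (intro ln_le_minus_one) simp
    then have "law X v * (ln (Q v) - ln (law X v)) \<le> law X v * (Q v / law X v - 1)"
      using p q by (intro mult_left_mono) (auto simp: ln_div)
    also have "\<dots> = Q v - law X v" using p by (simp add: field_simps)
    finally have "law X v * (ln (Q v) - ln (law X v)) / ln 2 \<le> (Q v - law X v) / ln 2"
      by (rule divide_right_mono) simp
    then show ?thesis by (simp add: log_def diff_divide_distrib right_diff_distrib)
  qed
  then have "(\<Sum>v\<in>X ` space M. law X v * - log 2 (law X v) - law X v * - log 2 (Q v))
      \<le> (\<Sum>v\<in>X ` space M. (Q v - law X v) / ln 2)" by (rule sum_mono)
  also have "\<dots> = ((\<Sum>v\<in>X ` space M. Q v) - (\<Sum>v\<in>X ` space M. law X v)) / ln 2"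
    by (simp only: sum_divide_distrib[symmetric] sum_subtractf)
  also have "\<dots> \<le> 0" using sum law_sum[OF X] by (simp add: divide_nonpos_pos)
  finally show ?thesis
    unfolding fin_entropy_law expectation_finite_rv(1)[OF X, of "\<lambda>v. - log 2 (Q v)"]
    by (simp add: sum_subtractf sum_negf)
qed

lemma law_le_1: "law X v \<le> 1"
  by (simp add: law_def)

lemma fin_entropy_nonneg: "fin_entropy M X \<ge> 0"
proof -
  have "law X v * - log 2 (law X v) \<ge> 0" for v
    using law_nonneg[of X v] law_le_1[of X v]
    by (cases "law X v = 0") (auto simp: mult_le_0_iff)
  then show ?thesis unfolding fin_entropy_law by (intro sum_nonneg)
qed

text \<open>A level set of \<open>X\<close> lies inside one of \<open>f (X x)\<close>, so merging
  values raises probabilities and lowers the pointwise information.\<close>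

lemma fin_entropy_comp_le:
  assumes X: "finite_rv X"
  shows "fin_entropy M (\<lambda>x. f (X x)) \<le> fin_entropy M X"
proof -
  let ?Y = "\<lambda>x. f (X x)"
  have le: "law X (X x) \<le> law ?Y (f (X x))" for x
    unfolding law_def using finite_rv_sets[OF X] finite_rv_sets[OF finite_rv_comp[OF X, of f]]
    by (intro finite_measure_mono) auto
  have "fin_entropy M ?Y = expectation (\<lambda>x. - log 2 (law ?Y (f (X x))))"
    using X by (simp only: fin_entropy_eq_expectation finite_rv_comp)
  also have "\<dots> \<le> expectation (\<lambda>x. - log 2 (law X (X x)))"
  proof (rule integral_mono_AE)
    show "AE x in M. - log 2 (law ?Y (f (X x))) \<le> - log 2 (law X (X x))"
      using AE_law_pos[OF X]
    proof eventually_elim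
      case (elim x)
      then show ?case using le[of x] by simp
    qed
  qed (intro expectation_finite_rv(2)[OF X, of "\<lambda>v. - log 2 (law X v)"]
             expectation_finite_rv(2)[OF X, of "\<lambda>v. - log 2 (law ?Y (f v))"])+
  also have "\<dots> = fin_entropy M X" using X by (simp only: fin_entropy_eq_expectation)
  finally show ?thesis .
qed

text \<open>\<open>r u\<close> is a guess for the conditional law of \<open>V\<close> given \<open>X = u\<close>. Constant guesses give
  subadditivity, guesses concentrated near a function of \<open>u\<close> give Fano-type bounds.\<close>
lemma fin_entropy_Pair_le:
  assumes X: "finite_rv X" and V: "finite_rv V"
    and r: "\<And>u v. r u v \<ge> 0" "\<And>u. (\<Sum>v\<in>V ` space M. r u v) \<le> 1"
    and pos: "AE x in M. r (X x) (V x) > 0"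
  shows "fin_entropy M (\<lambda>x. (X x, V x)) \<le> fin_entropy M X + expectation (\<lambda>x. - log 2 (r (X x) (V x)))"
proof -
  let ?W = "\<lambda>x. (X x, V x)"
  \<comment> \<open>The guessed joint law: the true law of \<open>X\<close> times the guess. Its
    logarithm splits into the two terms of the bound.\<close>
  define Q where "Q w = law X (fst w) * r (fst w) (snd w)" for w
  have W: "finite_rv ?W" using X V by (rule finite_rv_Pair)
  have fin: "finite (X ` space M)" "finite (V ` space M)" using X V by (simp_all add: finite_rv_finite)
  have "(\<Sum>w\<in>?W ` space M. Q w) \<le> (\<Sum>w\<in>X ` space M \<times> V ` space M. Q w)"
    unfolding Q_def using fin law_nonneg r(1) by (intro sum_mono2) (auto intro!: mult_nonneg_nonneg)
  also have "\<dots> = (\<Sum>u\<in>X ` space M. \<Sum>v\<in>V ` space M. law X u * r u v)"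
    unfolding Q_def by (simp add: sum.cartesian_product case_prod_beta)
  also have "\<dots> = (\<Sum>u\<in>X ` space M. law X u * (\<Sum>v\<in>V ` space M. r u v))"
    by (simp add: sum_distrib_left)
  also have "\<dots> \<le> (\<Sum>u\<in>X ` space M. law X u * 1)"
    using r(2) law_nonneg by (intro sum_mono mult_left_mono)
  also have "\<dots> = 1" using law_sum[OF X] by simp
  finally have "(\<Sum>w\<in>?W ` space M. Q w) \<le> 1" .
  moreover have AE: "AE x in M. law X (X x) > 0 \<and> r (X x) (V x) > 0"
    using AE_law_pos[OF X] pos by eventually_elim simp
  then have "AE x in M. Q (?W x) > 0" by (auto simp: Q_def elim!: AE_mp)
  ultimately have "fin_entropy M ?W \<le> expectation (\<lambda>x. - log 2 (Q (?W x)))"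
    using W by (intro gibbs_inequality) (auto simp: Q_def law_nonneg r(1))
  also have "\<dots> = expectation (\<lambda>x. - log 2 (law X (X x)) + - log 2 (r (X x) (V x)))"
  proof (rule integral_cong_AE)
    show "AE x in M. - log 2 (Q (?W x)) = - log 2 (law X (X x)) + - log 2 (r (X x) (V x))"
      using AE by eventually_elim (simp add: Q_def log_mult)
  qed (use expectation_finite_rv(2)[OF W, of "\<lambda>w. - log 2 (Q w)"]
           expectation_finite_rv(2)[OF W, of "\<lambda>w. - log 2 (law X (fst w)) + - log 2 (r (fst w) (snd w))"]
        in auto)
  also have "\<dots> = expectation (\<lambda>x. - log 2 (law X (X x))) + expectation (\<lambda>x. - log 2 (r (X x) (V x)))"
    using expectation_finite_rv(2)[OF X, of "\<lambda>u. - log 2 (law X u)"]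
      expectation_finite_rv(2)[OF W, of "\<lambda>w. - log 2 (r (fst w) (snd w))"]
    by (intro Bochner_Integration.integral_add) auto
  finally show ?thesis by (simp only: fin_entropy_eq_expectation[OF X])
qed

end

section \<open>Entropy rate of a finite partition along orbits\<close>

context measure_preserving_system begin

lemma finite_rv_funpow_T:
  assumes X: "finite_rv X" shows "finite_rv (\<lambda>x. X ((T ^^ n) x))"
proof -
  have "(\<lambda>x. X ((T ^^ n) x)) ` space M \<subseteq> X ` space M"
    using measurable_space[OF funpow_T_measurable] by auto
  then show ?thesis
    using X measurable_compose[OF funpow_T_measurable finite_rv_measurable[OF X]]
    unfolding finite_rv_def by (auto intro: finite_subset)
qed

lemma law_funpow_T:
  assumes X: "finite_rv X" shows "law (\<lambda>x. X ((T ^^ n) x)) v = law X v"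
proof -
  have "law X v = measure (distr M M (T ^^ n)) (X -` {v} \<inter> space M)"
    by (simp add: law_def distr_funpow_T)
  also have "\<dots> = prob ((T ^^ n) -` (X -` {v} \<inter> space M) \<inter> space M)"
    using finite_rv_sets[OF X] by (intro measure_distr) auto
  also have "(T ^^ n) -` (X -` {v} \<inter> space M) \<inter> space M = (\<lambda>x. X ((T ^^ n) x)) -` {v} \<inter> space M"
    using measurable_space[OF funpow_T_measurable] by auto
  finally show ?thesis by (simp add: law_def)
qed

lemma fin_entropy_funpow_T:
  assumes X: "finite_rv X" shows "fin_entropy M (\<lambda>x. X ((T ^^ n) x)) = fin_entropy M X"
proof -
  have "fin_entropy M (\<lambda>x. X ((T ^^ n) x)) = expectation (\<lambda>x. - log 2 (law X (X ((T ^^ n) x))))"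
    using law_funpow_T[OF X, of n]
    by (simp only: fin_entropy_eq_expectation[OF finite_rv_funpow_T[OF X]])
  also have "\<dots> = expectation (\<lambda>x. - log 2 (law X (X x)))"
    using expectation_finite_rv(2)[OF X, of "\<lambda>v. - log 2 (law X v)"]
    by (intro integral_funpow_T) auto
  finally show ?thesis by (simp only: fin_entropy_eq_expectation[OF X])
qed

definition orbit_word :: "('b \<Rightarrow> 'c) \<Rightarrow> nat \<Rightarrow> 'b \<Rightarrow> 'c list" where
  "orbit_word \<xi> n x = map (\<lambda>i. \<xi> ((T ^^ i) x)) [0..<n]"

lemma orbit_word_add: "orbit_word \<xi> (m + n) x = orbit_word \<xi> m x @ orbit_word \<xi> n ((T ^^ m) x)"
proof (rule nth_equalityI)
  fix i assume "i < length (orbit_word \<xi> (m + n) x)"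
  then show "orbit_word \<xi> (m + n) x ! i = (orbit_word \<xi> m x @ orbit_word \<xi> n ((T ^^ m) x)) ! i"
    using funpow_add[of "i - m" m T] by (auto simp: orbit_word_def nth_append)
qed (simp add: orbit_word_def)

lemma orbit_word_Suc: "orbit_word \<xi> (Suc n) x = orbit_word \<xi> n x @ [\<xi> ((T ^^ n) x)]"
  by (simp add: orbit_word_def)

lemma finite_rv_orbit_word:
  assumes "finite_rv \<xi>" shows "finite_rv (orbit_word \<xi> n)"
proof (induction n)
  case 0
  have "(\<lambda>x. []) ` space M \<subseteq> {[]}" by auto
  then have "finite ((\<lambda>x. []) ` space M)" by (rule finite_subset) simp
  then show ?case by (simp add: finite_rv_def orbit_word_def[abs_def])
next
  case (Suc n)
  have "finite_rv (\<lambda>x. (\<lambda>(u, v). u @ [v]) (orbit_word \<xi> n x, \<xi> ((T ^^ n) x)))"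
    by (rule finite_rv_comp[OF finite_rv_Pair[OF Suc finite_rv_funpow_T[OF assms]]])
  then show ?case by (simp add: orbit_word_Suc[abs_def])
qed

text \<open>The second half of the word is guessed by its own law, whatever the first half is; by
  invariance this costs the entropy of the unshifted word.\<close>

lemma fin_entropy_orbit_word_subadditive:
  assumes "finite_rv \<xi>"
  shows "fin_entropy M (orbit_word \<xi> (m + n))
      \<le> fin_entropy M (orbit_word \<xi> m) + fin_entropy M (orbit_word \<xi> n)"
proof -
  let ?X = "orbit_word \<xi> m" and ?V = "\<lambda>x. orbit_word \<xi> n ((T ^^ m) x)"
  have X: "finite_rv ?X" using assms by (rule finite_rv_orbit_word)
  have V: "finite_rv ?V" using finite_rv_orbit_word[OF assms] by (rule finite_rv_funpow_T)
  have "fin_entropy M (\<lambda>x. (\<lambda>(u, v). u @ v) (?X x, ?V x)) \<le> fin_entropy M (\<lambda>x. (?X x, ?V x))"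
    by (intro fin_entropy_comp_le finite_rv_Pair X V)
  also have "\<dots> \<le> fin_entropy M ?X + expectation (\<lambda>x. - log 2 (law ?V (?V x)))"
    using AE_law_pos[OF V] law_sum[OF V]
    by (intro fin_entropy_Pair_le[where r = "\<lambda>u. law ?V"] X V) (auto simp: law_nonneg)
  also have "expectation (\<lambda>x. - log 2 (law ?V (?V x))) = fin_entropy M (orbit_word \<xi> n)"
    by (simp only: fin_entropy_eq_expectation[OF V, symmetric]
        fin_entropy_funpow_T[OF finite_rv_orbit_word[OF assms]])
  finally show ?thesis by (simp add: orbit_word_add[abs_def])
qed

text \<open>The rate is defined by \<open>lim\<close>, which is informative only once convergence is
  known; Fekete's lemma provides it and identifies the limit as an infimum.\<close>

lemma partition_entropy_rate_tendsto:
  assumes "finite_rv \<xi>"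
  shows "(\<lambda>n. fin_entropy M (orbit_word \<xi> n) / real n) \<longlonglongrightarrow> partition_entropy_rate M T \<xi>"
    and "n \<ge> 1 \<Longrightarrow> partition_entropy_rate M T \<xi> \<le> fin_entropy M (orbit_word \<xi> n) / real n"
proof -
  let ?a = "\<lambda>n. fin_entropy M (orbit_word \<xi> n)"
  have lim: "(\<lambda>n. ?a n / real n) \<longlonglongrightarrow> (INF n\<in>{1..}. ?a n / real n)"
    using fin_entropy_orbit_word_subadditive[OF assms] fin_entropy_nonneg by (rule fekete)
  moreover have eq: "partition_entropy_rate M T \<xi> = (INF n\<in>{1..}. ?a n / real n)"
    unfolding partition_entropy_rate_def using limI[OF lim] by (simp add: orbit_word_def[abs_def])
  ultimately show "(\<lambda>n. ?a n / real n) \<longlonglongrightarrow> partition_entropy_rate M T \<xi>" by simp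
  have "bdd_below ((\<lambda>n. ?a n / real n) ` {1..})"
    by (rule bdd_belowI2[of _ 0]) (simp add: fin_entropy_nonneg)
  then show "n \<ge> 1 \<Longrightarrow> partition_entropy_rate M T \<xi> \<le> ?a n / real n"
    unfolding eq by (intro cINF_lower) auto
qed

end

section \<open>The shift and its generator\<close>

lemma length_prefix [simp]: "length (prefix n \<omega>) = n"
  by (simp add: prefix_def)

lemma nth_prefix [simp]: "i < n \<Longrightarrow> prefix n \<omega> ! i = \<omega> i"
  by (simp add: prefix_def)

lemma take_prefix: "m \<le> n \<Longrightarrow> take m (prefix n \<omega>) = prefix m \<omega>"
  by (rule nth_equalityI) auto

lemma funpow_shift_apply: "(shift ^^ n) \<omega> i = \<omega> (i + n)"
  by (induction n arbitrary: i) (simp_all add: shift_def)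

lemma take_drop_prefix: "k + m \<le> n \<Longrightarrow> take m (drop k (prefix n \<omega>)) = prefix m ((shift ^^ k) \<omega>)"
  by (rule nth_equalityI) (auto simp: funpow_shift_apply add.commute)

locale shift_system = prob_space M for M :: "(nat \<Rightarrow> 'a::finite) measure" +
  assumes sets_M: "sets M = shift_sets" and invariant: "invariant_measure shift M"
begin

lemma space_M [simp]: "space M = UNIV"
proof -
  have "space M = space (PiM UNIV (\<lambda>_::nat. count_space (UNIV::'a set)))"
    using sets_M unfolding shift_sets_def by (rule sets_eq_imp_space_eq)
  then show ?thesis by (simp add: space_PiM)
qed

lemma prob_UNIV [simp]: "prob UNIV = 1"
  using prob_space by simp

lemma coordinate_measurable [measurable]: "(\<lambda>\<omega>. \<omega> i) \<in> M \<rightarrow>\<^sub>M count_space UNIV"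
  using measurable_component_singleton[of i UNIV "\<lambda>_. count_space UNIV"]
  by (simp add: measurable_cong_sets[OF sets_M[unfolded shift_sets_def] refl])

lemma shift_measurable: "shift \<in> M \<rightarrow>\<^sub>M M"
proof -
  have "shift \<in> M \<rightarrow>\<^sub>M PiM UNIV (\<lambda>_::nat. count_space (UNIV::'a set))"
    by (rule measurable_PiM_single') (auto simp: shift_def)
  then show ?thesis
    by (simp add: measurable_cong_sets[OF refl sets_M[unfolded shift_sets_def]])
qed

sublocale measure_preserving_system M shift
proof
  show "distr M M shift = M"
    using invariant shift_measurable
    by (intro measure_eqI) (auto simp: emeasure_distr invariant_measure_def)
qed (rule shift_measurable)

lemma finite_rv_coordinate: "finite_rv (\<lambda>\<omega>. \<omega> 0)"
  using coordinate_measurable[of 0] by (simp add: finite_rv_def)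

lemma prefix_eq_orbit_word: "prefix n = orbit_word (\<lambda>\<omega>. \<omega> 0) n"
  by (auto simp: prefix_def orbit_word_def funpow_shift_apply)

lemma finite_rv_prefix: "finite_rv (prefix n)"
  using finite_rv_orbit_word[OF finite_rv_coordinate] by (simp add: prefix_eq_orbit_word)

abbreviation block_entropy :: "nat \<Rightarrow> real" where
  "block_entropy n \<equiv> fin_entropy M (prefix n)"

section \<open>Approximation of events and partitions by cylinders\<close>

lemma cylinder_sets [measurable]: "{\<omega>. prefix n \<omega> \<in> B} \<in> sets M"
  using finite_rv_sets[OF finite_rv_prefix, of n B] by (simp add: vimage_def)

text \<open>Approximable events include the coordinate events and are closed under complements and
  countable unions. A union is cut down to \<open>k\<close> members by continuity of the measure at
  a loss of \<open>e / 2\<close>; the other \<open>e / 2\<close> is shared among these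
  members.\<close>

lemma cylinder_approximation:
  assumes "A \<in> sets M" "e > 0"
  shows "\<exists>N B. prob {\<omega>. (\<omega> \<in> A) \<noteq> (prefix N \<omega> \<in> B)} < e"
proof -
  have sets_eq: "sets M = sigma_sets UNIV {{f. f i \<in> S} | (i::nat) S. S \<in> sets (count_space (UNIV :: 'a set))}"
    unfolding sets_M shift_sets_def by (simp add: sets_PiM_single)
  have sd: "{\<omega>. (\<omega> \<in> A) \<noteq> (prefix N \<omega> \<in> B)} \<in> sets M" if "A \<in> sets M" for A N B
  proof -
    have "{\<omega>. (\<omega> \<in> A) \<noteq> (prefix N \<omega> \<in> B)}
        = (A - {\<omega>. prefix N \<omega> \<in> B}) \<union> ({\<omega>. prefix N \<omega> \<in> B} - A)" by auto
    then show ?thesis using that by simp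
  qed
  have "A \<in> sigma_sets UNIV {{f. f i \<in> S} | (i::nat) S. S \<in> sets (count_space (UNIV :: 'a set))}"
    using assms(1) sets_eq by simp
  then show ?thesis using assms(2)
  proof (induction arbitrary: e rule: sigma_sets.induct)
    case (Basic A)
    then obtain i S where A: "A = {f. f i \<in> S}" by auto
    have "{\<omega>. (\<omega> \<in> A) \<noteq> (prefix (Suc i) \<omega> \<in> {w. w ! i \<in> S})} = {}" using A by auto
    then have "prob {\<omega>. (\<omega> \<in> A) \<noteq> (prefix (Suc i) \<omega> \<in> {w. w ! i \<in> S})} < e"
      using Basic.prems by (simp only: measure_empty)
    then show ?case by blast
  next
    case Empty
    have "prob {\<omega>. (\<omega> \<in> {}) \<noteq> (prefix 0 \<omega> \<in> ({} :: 'a list set))} < e"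
      using Empty by simp
    then show ?case by blast
  next
    case (Compl A)
    then obtain N B where "prob {\<omega>. (\<omega> \<in> A) \<noteq> (prefix N \<omega> \<in> B)} < e" by blast
    moreover have "{\<omega>. (\<omega> \<in> UNIV - A) \<noteq> (prefix N \<omega> \<in> - B)} = {\<omega>. (\<omega> \<in> A) \<noteq> (prefix N \<omega> \<in> B)}"
      by auto
    ultimately have "prob {\<omega>. (\<omega> \<in> UNIV - A) \<noteq> (prefix N \<omega> \<in> - B)} < e" by simp
    then show ?case by blast
  next
    case (Union A)
    have A: "A i \<in> sets M" for i using Union.hyps sets_eq by simp
    define P where "P k = (\<Union>i<k. A i)" for k
    have "incseq P" unfolding P_def by (intro monoI UN_mono) auto
    moreover have "range P \<subseteq> sets M" using A by (auto simp: P_def)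
    ultimately have "(\<lambda>k. prob (P k)) \<longlonglongrightarrow> prob (\<Union>k. P k)"
      by (intro finite_Lim_measure_incseq)
    moreover have "(\<Union>k. P k) = (\<Union>i. A i)" by (auto simp: P_def)
    ultimately have "eventually (\<lambda>k. prob (P k) > prob (\<Union>i. A i) - e / 2) sequentially"
      using Union.prems by (intro order_tendstoD) auto
    then obtain k where k: "prob (P k) > prob (\<Union>i. A i) - e / 2"
      by (auto simp: eventually_sequentially)
    have "\<forall>i. \<exists>N B. prob {\<omega>. (\<omega> \<in> A i) \<noteq> (prefix N \<omega> \<in> B)} < e / (2 * (real k + 1))"
      using Union.IH Union.prems by simp
    then obtain N B where NB:
      "\<And>i. prob {\<omega>. (\<omega> \<in> A i) \<noteq> (prefix (N i) \<omega> \<in> B i)} < e / (2 * (real k + 1))"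
      by metis
    \<comment> \<open>A common length above all \<open>N i\<close>; \<open>take\<close> recovers the
      shorter prefixes.\<close>
    define N' where "N' = (\<Sum>i<k. N i)"
    have N': "N i \<le> N'" if "i < k" for i
      unfolding N'_def by (rule member_le_sum) (use that in auto)
    define B' where "B' = {w. \<exists>i<k. take (N i) w \<in> B i}"
    have B': "prefix N' \<omega> \<in> B' \<longleftrightarrow> (\<exists>i<k. prefix (N i) \<omega> \<in> B i)" for \<omega>
      unfolding B'_def by (auto simp: take_prefix[OF N'])
    let ?D = "\<lambda>i. {\<omega>. (\<omega> \<in> A i) \<noteq> (prefix (N i) \<omega> \<in> B i)}"
    have PA: "P k \<in> sets M" "(\<Union>i. A i) \<in> sets M" using A by (auto simp: P_def)
    have DU: "(\<Union>i<k. ?D i) \<in> sets M" by (rule sets.finite_UN[OF finite_lessThan sd[OF A]])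
    have "prob {\<omega>. (\<omega> \<in> (\<Union>i. A i)) \<noteq> (prefix N' \<omega> \<in> B')} \<le> prob (((\<Union>i. A i) - P k) \<union> (\<Union>i<k. ?D i))"
    proof (rule finite_measure_mono)
      show "{\<omega>. (\<omega> \<in> (\<Union>i. A i)) \<noteq> (prefix N' \<omega> \<in> B')} \<subseteq> ((\<Union>i. A i) - P k) \<union> (\<Union>i<k. ?D i)"
        unfolding B' P_def by auto
      show "((\<Union>i. A i) - P k) \<union> (\<Union>i<k. ?D i) \<in> sets M"
        by (rule sets.Un[OF sets.Diff[OF PA(2,1)] DU])
    qed
    also have "\<dots> \<le> prob ((\<Union>i. A i) - P k) + prob (\<Union>i<k. ?D i)"
      by (rule measure_Un_le[OF sets.Diff[OF PA(2,1)] DU])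
    also have "prob (\<Union>i<k. ?D i) \<le> (\<Sum>i<k. prob (?D i))"
      by (rule measure_UNION_le[OF finite_lessThan sd[OF A]])
    also have "\<dots> \<le> (\<Sum>i<k. e / (2 * (real k + 1)))"
      by (rule sum_mono) (rule less_imp_le[OF NB])
    also have "\<dots> \<le> e / 2" using Union.prems by (simp add: field_simps)
    also have "prob ((\<Union>i. A i) - P k) = prob (\<Union>i. A i) - prob (P k)"
      by (rule finite_measure_Diff[OF PA(2,1)]) (auto simp: P_def)
    also have "\<dots> < e / 2" using k by simp
    finally have "prob {\<omega>. (\<omega> \<in> (\<Union>i. A i)) \<noteq> (prefix N' \<omega> \<in> B')} < e" by simp
    then show ?case by blast
  qed
qed

text \<open>Each level set is approximated separately. Outside the union of the error sets exactly
  one value passes its test, so the choice made by \<open>\<phi>\<close> is the true value.\<close>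

lemma finite_rv_approximation:
  assumes \<xi>: "finite_rv \<xi>" and "\<delta> > 0"
  shows "\<exists>N \<phi>. prob {\<omega>. \<xi> \<omega> \<noteq> \<phi> (prefix N \<omega>)} \<le> \<delta>"
proof -
  let ?V = "range \<xi>"
  have fin: "finite ?V" using finite_rv_finite[OF \<xi>] by simp
  have A: "\<xi> -` {v} \<in> sets M" for v using finite_rv_sets[OF \<xi>, of "{v}"] by simp
  have "\<forall>v. \<exists>N B. prob {\<omega>. (\<omega> \<in> \<xi> -` {v}) \<noteq> (prefix N \<omega> \<in> B)} < \<delta> / (real (card ?V) + 1)"
    by (intro allI cylinder_approximation[OF A]) (use \<open>\<delta> > 0\<close> in simp)
  from choice[OF this] obtain N where
    "\<forall>v. \<exists>B. prob {\<omega>. (\<omega> \<in> \<xi> -` {v}) \<noteq> (prefix (N v) \<omega> \<in> B)} < \<delta> / (real (card ?V) + 1)"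
    by blast
  from choice[OF this] obtain B where NB:
    "\<And>v. prob {\<omega>. (\<omega> \<in> \<xi> -` {v}) \<noteq> (prefix (N v) \<omega> \<in> B v)} < \<delta> / (real (card ?V) + 1)"
    by blast
  let ?D = "\<lambda>v. {\<omega>. (\<omega> \<in> \<xi> -` {v}) \<noteq> (prefix (N v) \<omega> \<in> B v)}"
  have D: "?D v \<in> sets M" for v
  proof -
    have "?D v = (\<xi> -` {v} - {\<omega>. prefix (N v) \<omega> \<in> B v}) \<union> ({\<omega>. prefix (N v) \<omega> \<in> B v} - \<xi> -` {v})" by auto
    then show ?thesis using A by simp
  qed
  define N' where "N' = (\<Sum>v\<in>?V. N v)"
  have N': "N v \<le> N'" if "v \<in> ?V" for v
    unfolding N'_def by (rule member_le_sum) (use that fin in auto)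
  define \<phi> where "\<phi> w = (SOME v. v \<in> ?V \<and> take (N v) w \<in> B v)" for w
  have "{\<omega>. \<xi> \<omega> \<noteq> \<phi> (prefix N' \<omega>)} \<subseteq> (\<Union>v\<in>?V. ?D v)"
  proof
    fix \<omega> assume "\<omega> \<in> {\<omega>. \<xi> \<omega> \<noteq> \<phi> (prefix N' \<omega>)}"
    show "\<omega> \<in> (\<Union>v\<in>?V. ?D v)"
    proof (rule ccontr)
      assume "\<omega> \<notin> (\<Union>v\<in>?V. ?D v)"
      then have *: "(take (N v) (prefix N' \<omega>) \<in> B v) = (\<xi> \<omega> = v)" if "v \<in> ?V" for v
        using that take_prefix[OF N'[OF that], of \<omega>] by auto
      have "(v \<in> ?V \<and> take (N v) (prefix N' \<omega>) \<in> B v) = (v = \<xi> \<omega>)" for v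
      proof (cases "v \<in> ?V")
        case True
        then show ?thesis using *[OF True] by (simp add: eq_commute)
      qed auto
      then have "\<phi> (prefix N' \<omega>) = \<xi> \<omega>"
        unfolding \<phi>_def by (simp only: some_eq_trivial)
      then show False using \<open>\<omega> \<in> {\<omega>. \<xi> \<omega> \<noteq> \<phi> (prefix N' \<omega>)}\<close> by simp
    qed
  qed
  then have "prob {\<omega>. \<xi> \<omega> \<noteq> \<phi> (prefix N' \<omega>)} \<le> prob (\<Union>v\<in>?V. ?D v)"
    using fin D by (intro finite_measure_mono sets.finite_UN) auto
  also have "\<dots> \<le> (\<Sum>v\<in>?V. prob (?D v))"
    by (rule measure_UNION_le[OF fin D])
  also have "\<dots> \<le> (\<Sum>v\<in>?V. \<delta> / (real (card ?V) + 1))"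
    by (rule sum_mono) (rule less_imp_le[OF NB])
  also have "\<dots> \<le> \<delta>" using \<open>\<delta> > 0\<close> by (simp add: field_simps)
  finally show ?thesis by blast
qed

text \<open>Reading a block of length \<open>n + N\<close> determines \<open>\<xi>\<close> along the orbit up to rare errors. Each of the
  \<open>n\<close> symbols then costs at most a small amount of additional entropy.\<close>
lemma fin_entropy_orbit_word_le_block:
  fixes \<xi> :: "(nat \<Rightarrow> 'a) \<Rightarrow> 'c"
  assumes \<xi>: "finite_rv \<xi>" and \<delta>: "0 < \<delta>" "\<delta> < 1"
    and approx: "prob {\<omega>. \<xi> \<omega> \<noteq> \<phi> (prefix N \<omega>)} \<le> \<delta>"
  shows "fin_entropy M (orbit_word \<xi> n)
      \<le> block_entropy (n + N) + real n * (- log 2 (1 - \<delta>) + \<delta> * log 2 (real (card (range \<xi>)) / \<delta>))"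
proof -
  let ?V = "range \<xi>"
  define m where "m = real (card ?V)"
  have fin: "finite ?V" using finite_rv_finite[OF \<xi>] by simp
  then have m: "m \<ge> 1" unfolding m_def by (simp add: Suc_leI card_gt_0_iff)
  define c where "c = - log 2 (1 - \<delta>) + \<delta> * log 2 (m / \<delta>)"
  \<comment> \<open>A correct prediction costs \<open>- log 2 (1 - \<delta>)\<close>, a wrong one
    \<open>log 2 (m / \<delta>)\<close>. The total mass over the range is at most 1 even if
    \<open>b\<close> lies outside it.\<close>
  define guess :: "'c \<Rightarrow> 'c \<Rightarrow> real" where "guess b v = (if v = b then 1 - \<delta> else \<delta> / m)" for b v
  have guess_pos: "guess b v > 0" for b v using \<delta> m by (simp add: guess_def)
  have guess_sum: "(\<Sum>v\<in>W. guess b v) \<le> 1" if "W \<subseteq> ?V" for b W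
  proof -
    have "(\<Sum>v\<in>W. guess b v) \<le> (\<Sum>v\<in>?V. guess b v)"
      using that fin guess_pos by (intro sum_mono2) (auto intro: less_imp_le)
    also have "\<dots> \<le> (\<Sum>v\<in>?V. (if v = b then 1 - \<delta> else 0) + \<delta> / m)"
      using \<delta> m by (intro sum_mono) (simp add: guess_def)
    also have "\<dots> = (if b \<in> ?V then 1 - \<delta> else 0) + \<delta>"
      using fin m by (simp add: sum.distrib m_def)
    also have "\<dots> \<le> 1" using \<delta> by simp
    finally show ?thesis .
  qed
  define g where "g \<omega> = - log 2 (guess (\<phi> (prefix N \<omega>)) (\<xi> \<omega>))" for \<omega>
  have pair: "finite_rv (\<lambda>\<omega>. (prefix N \<omega>, \<xi> \<omega>))" using finite_rv_prefix \<xi> by (rule finite_rv_Pair)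
  have g_int: "integrable M g"
    unfolding g_def using expectation_finite_rv(2)[OF pair, of "\<lambda>u. - log 2 (guess (\<phi> (fst u)) (snd u))"] by simp
  let ?bad = "{\<omega>. \<xi> \<omega> \<noteq> \<phi> (prefix N \<omega>)}"
  have bad: "?bad \<in> sets M"
    using finite_rv_sets[OF pair, of "{u. snd u \<noteq> \<phi> (fst u)}"] by (simp add: vimage_def)
  have "expectation g \<le> expectation (\<lambda>\<omega>. - log 2 (1 - \<delta>) + indicator ?bad \<omega> * log 2 (m / \<delta>))"
  proof (rule integral_mono)
    show "integrable M (\<lambda>\<omega>. - log 2 (1 - \<delta>) + indicator ?bad \<omega> * log 2 (m / \<delta>))"
      using bad by (intro Bochner_Integration.integrable_add integrable_mult_left) (auto simp: emeasure_eq_measure)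
    have "log 2 (1 - \<delta>) \<le> 0" using \<delta> by simp
    moreover have "log 2 (\<delta> / m) = - log 2 (m / \<delta>)" using \<delta> m by (simp add: log_divide)
    ultimately show "g \<omega> \<le> - log 2 (1 - \<delta>) + indicator ?bad \<omega> * log 2 (m / \<delta>)" for \<omega>
      by (auto simp: g_def guess_def)
  qed (rule g_int)
  also have "\<dots> = - log 2 (1 - \<delta>) + prob ?bad * log 2 (m / \<delta>)"
    using bad by (subst Bochner_Integration.integral_add) (auto simp: prob_space emeasure_eq_measure)
  also have "\<dots> \<le> c"
    unfolding c_def using approx \<delta> m by (intro add_left_mono mult_right_mono) auto
  finally have g_le: "expectation g \<le> c" .
  \<comment> \<open>Predicting the label at time \<open>k < n\<close> reads coordinates
    \<open>k\<close> to \<open>k + N - 1\<close>, all within this block.\<close>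
  let ?L = "n + N"
  \<comment> \<open>The block is kept as side information while labels are appended one by one; by
    invariance each of them costs \<open>expectation g\<close>.\<close>
  have "fin_entropy M (\<lambda>\<omega>. (orbit_word \<xi> k \<omega>, prefix ?L \<omega>)) \<le> block_entropy ?L + real k * c" if "k \<le> n" for k
    using that
  proof (induction k)
    case 0
    have "fin_entropy M (\<lambda>\<omega>. (\<lambda>w. ([], w)) (prefix ?L \<omega>)) \<le> block_entropy ?L"
      by (rule fin_entropy_comp_le[OF finite_rv_prefix])
    then show ?case by (simp add: orbit_word_def)
  next
    case (Suc k)
    let ?X = "\<lambda>\<omega>. (orbit_word \<xi> k \<omega>, prefix ?L \<omega>)" and ?V = "\<lambda>\<omega>. \<xi> ((shift ^^ k) \<omega>)"
    let ?r = "\<lambda>u. guess (\<phi> (take N (drop k (snd u))))"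
    have X: "finite_rv ?X" by (rule finite_rv_Pair[OF finite_rv_orbit_word[OF \<xi>] finite_rv_prefix])
    have V: "finite_rv ?V" by (rule finite_rv_funpow_T[OF \<xi>])
    have "fin_entropy M (\<lambda>\<omega>. (\<lambda>u. (fst (fst u) @ [snd u], snd (fst u))) (?X \<omega>, ?V \<omega>))
        \<le> fin_entropy M (\<lambda>\<omega>. (?X \<omega>, ?V \<omega>))"
      by (rule fin_entropy_comp_le[OF finite_rv_Pair[OF X V]])
    also have "\<dots> \<le> fin_entropy M ?X + expectation (\<lambda>\<omega>. - log 2 (?r (?X \<omega>) (?V \<omega>)))"
      using guess_pos by (intro fin_entropy_Pair_le X V guess_sum) (auto intro: less_imp_le)
    also have "(\<lambda>\<omega>. - log 2 (?r (?X \<omega>) (?V \<omega>))) = (\<lambda>\<omega>. g ((shift ^^ k) \<omega>))"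
      using Suc.prems by (simp add: g_def take_drop_prefix)
    also have "expectation \<dots> = expectation g"
      using g_int by (intro integral_funpow_T) auto
    finally show ?case using Suc g_le by (simp add: orbit_word_Suc[abs_def] algebra_simps)
  qed
  from this[of n] have "fin_entropy M (\<lambda>\<omega>. (orbit_word \<xi> n \<omega>, prefix ?L \<omega>)) \<le> block_entropy ?L + real n * c" by simp
  moreover have "fin_entropy M (\<lambda>\<omega>. fst (orbit_word \<xi> n \<omega>, prefix ?L \<omega>))
      \<le> fin_entropy M (\<lambda>\<omega>. (orbit_word \<xi> n \<omega>, prefix ?L \<omega>))"
    by (rule fin_entropy_comp_le[OF finite_rv_Pair[OF finite_rv_orbit_word[OF \<xi>] finite_rv_prefix]])
  ultimately show ?thesis by (simp add: c_def m_def)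
qed

text \<open>The partition by the first symbol, coded numerically because
  \<open>fin_partition\<close> wants labels in \<open>nat\<close>.\<close>

definition generator :: "(nat \<Rightarrow> 'a) \<Rightarrow> nat" where
  "generator \<omega> = sym_index (\<omega> 0)"

lemma finite_rv_generator: "finite_rv generator"
  using finite_rv_comp[OF finite_rv_coordinate, of sym_index] by (simp add: generator_def[abs_def])

lemma fin_entropy_generator: "fin_entropy M (orbit_word generator n) = block_entropy n"
proof -
  have eq: "orbit_word generator n = (\<lambda>\<omega>. map sym_index (prefix n \<omega>))"
    by (auto simp: orbit_word_def prefix_def generator_def funpow_shift_apply)
  have "inj (sym_index :: 'a \<Rightarrow> nat)" by (rule inj_sym_index)
  then have inv: "(\<lambda>\<omega>. map (inv sym_index) (orbit_word generator n \<omega>)) = prefix n"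
    by (auto simp: eq comp_def)
  have "block_entropy n \<le> fin_entropy M (orbit_word generator n)"
    using fin_entropy_comp_le[OF finite_rv_orbit_word[OF finite_rv_generator], of "map (inv sym_index :: nat \<Rightarrow> 'a)" n]
    unfolding inv .
  moreover have "fin_entropy M (orbit_word generator n) \<le> block_entropy n"
    unfolding eq by (rule fin_entropy_comp_le[OF finite_rv_prefix])
  ultimately show ?thesis by simp
qed

text \<open>For fixed \<open>\<delta>\<close> the excess \<open>block_entropy N\<close> disappears
  after division by \<open>n\<close>, leaving \<open>c \<delta>\<close>, which vanishes as
  \<open>\<delta>\<close> tends to 0.\<close>

lemma partition_entropy_rate_le_generator:
  assumes \<xi>: "finite_rv \<xi>"
  shows "partition_entropy_rate M shift \<xi> \<le> partition_entropy_rate M shift generator"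
proof -
  define m where "m = real (card (range \<xi>))"
  have "finite (range \<xi>)" using finite_rv_finite[OF \<xi>] by simp
  then have m: "m > 0" unfolding m_def by (simp add: card_gt_0_iff)
  define c where "c \<delta> = - log 2 (1 - \<delta>) + \<delta> * log 2 (m / \<delta>)" for \<delta>
  have le: "partition_entropy_rate M shift \<xi> \<le> partition_entropy_rate M shift generator + c \<delta>"
    if \<delta>: "0 < \<delta>" "\<delta> < 1" for \<delta>
  proof -
    obtain N \<phi> where "prob {\<omega>. \<xi> \<omega> \<noteq> \<phi> (prefix N \<omega>)} \<le> \<delta>"
      using finite_rv_approximation[OF \<xi> \<delta>(1)] by blast
    from fin_entropy_orbit_word_le_block[OF \<xi> \<delta> this]
    have bound: "fin_entropy M (orbit_word \<xi> n) \<le> block_entropy n + block_entropy N + real n * c \<delta>" for n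
      using fin_entropy_orbit_word_subadditive[OF finite_rv_generator, of n N]
      unfolding fin_entropy_generator c_def m_def by (meson add_right_mono order_trans)
    have "(\<lambda>n. block_entropy n / real n + block_entropy N / real n + c \<delta>)
        \<longlonglongrightarrow> partition_entropy_rate M shift generator + 0 + c \<delta>"
      using partition_entropy_rate_tendsto(1)[OF finite_rv_generator, unfolded fin_entropy_generator]
      by (intro tendsto_add tendsto_const lim_const_over_n)
    moreover have "fin_entropy M (orbit_word \<xi> n) / real n
        \<le> block_entropy n / real n + block_entropy N / real n + c \<delta>" if "n \<ge> 1" for n
      using divide_right_mono[OF bound[of n], of "real n"] that by (simp add: add_divide_distrib)
    ultimately show ?thesis
      using LIMSEQ_le[OF partition_entropy_rate_tendsto(1)[OF \<xi>]] by fastforce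
  qed
  have "(c \<longlongrightarrow> 0) (at_right 0)"
    unfolding c_def using m by real_asymp
  then have "((\<lambda>\<delta>. partition_entropy_rate M shift generator + c \<delta>)
      \<longlongrightarrow> partition_entropy_rate M shift generator + 0) (at_right 0)"
    by (intro tendsto_intros)
  moreover have "eventually (\<lambda>\<delta>::real. 0 < \<delta> \<and> \<delta> < 1) (at_right 0)"
    by (simp add: eventually_at_right_field) (meson zero_less_one)
  then have "eventually (\<lambda>\<delta>. partition_entropy_rate M shift \<xi>
      \<le> partition_entropy_rate M shift generator + c \<delta>) (at_right 0)"
    by eventually_elim (use le in auto)
  ultimately show ?thesis using tendsto_lowerbound by fastforce
qed

text \<open>A supremum of reals requires boundedness; exhibiting a maximum settles this along with
  the value.\<close>

lemma KS_entropy_eq: "KS_entropy M shift = partition_entropy_rate M shift generator"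
  unfolding KS_entropy_def
proof (rule cSup_eq_maximum)
  show "partition_entropy_rate M shift generator \<in> partition_entropy_rate M shift ` {\<xi>. fin_partition M \<xi>}"
    using finite_rv_generator by (simp add: fin_partition_def finite_rv_def)
qed (use partition_entropy_rate_le_generator in \<open>auto simp: fin_partition_def finite_rv_def\<close>)

lemma block_entropy_tendsto: "(\<lambda>n. block_entropy n / real n) \<longlonglongrightarrow> KS_entropy M shift"
  using partition_entropy_rate_tendsto(1)[OF finite_rv_generator]
  by (simp add: KS_entropy_eq fin_entropy_generator)

end

section \<open>Empirical entropy and algorithmic information\<close>

text \<open>The end point 0 is what matters, since words may have probability 0.\<close>

lemma continuous_on_mult_log: "continuous_on {0..} (\<lambda>x::real. x * log 2 x)"
  unfolding continuous_on_def
proof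
  fix x :: real assume "x \<in> {0..}"
  then consider "x = 0" | "x > 0" by force
  then show "((\<lambda>x. x * log 2 x) \<longlongrightarrow> x * log 2 x) (at x within {0..})"
  proof cases
    case 1
    have "((\<lambda>x::real. x * log 2 x) \<longlongrightarrow> 0) (at_right 0)" by real_asymp
    then show ?thesis by (simp add: 1 at_within_Ici_at_right)
  next
    case 2
    then show ?thesis by (intro tendsto_intros) auto
  qed
qed

lemma emp_freq_nonneg: "emp_freq s w \<ge> 0"
  by (simp add: emp_freq_def)

lemma finite_words: "finite {w::'a::finite list. length w = l}"
  using finite_lists_length_eq[of "UNIV :: 'a set" l] by simp

text \<open>A crude bound, uniform in \<open>s\<close>, from \<open>ln x\<close> \<le>
  \<open>x - 1\<close> at \<open>x = 1 / p\<close>; it serves to bound compressed lengths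
  linearly.\<close>

lemma emp_entropy_1_le:
  "emp_entropy 1 (s::'a::finite list) \<le> real (card {w::'a list. length w = 1}) / ln 2"
proof -
  have "- (p * log 2 p) \<le> 1 / ln 2" if "p \<ge> 0" for p :: real
  proof (cases "p = 0")
    case False
    then have p: "p > 0" using that by simp
    then have "ln (1 / p) \<le> 1 / p - 1" by (intro ln_le_minus_one) simp
    then have "p * ln (1 / p) \<le> p * (1 / p - 1)" using p by (intro mult_left_mono) auto
    also have "\<dots> \<le> 1" using p by (simp add: algebra_simps)
    finally have "p * ln (1 / p) / ln 2 \<le> 1 / ln 2" by (intro divide_right_mono) auto
    then show ?thesis using p by (simp add: log_def ln_div)
  qed simp
  then have "(\<Sum>w\<in>{w::'a list. length w = 1}. - (emp_freq s w * log 2 (emp_freq s w)))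
      \<le> (\<Sum>w\<in>{w::'a list. length w = 1}. 1 / ln 2)"
    by (intro sum_mono) (simp add: emp_freq_nonneg)
  then show ?thesis by (simp add: emp_entropy_def sum_negf)
qed

lemma sum_half_power_length:
  "(\<Sum>q\<in>{q::bool list. length q \<le> K}. (1/2) ^ length q) = (real K + 1 :: real)"
proof (induction K)
  case (Suc K)
  have "{q::bool list. length q \<le> Suc K} = {q. length q \<le> K} \<union> {q. length q = Suc K}" by auto
  moreover have "finite {q::bool list. length q \<le> K}"
    using finite_lists_length_le[of "UNIV :: bool set" K] by simp
  ultimately have "(\<Sum>q\<in>{q::bool list. length q \<le> Suc K}. (1/2::real) ^ length q)
      = (\<Sum>q\<in>{q::bool list. length q \<le> K}. (1/2) ^ length q) + (\<Sum>q\<in>{q::bool list. length q = Suc K}. (1/2) ^ length q)"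
    using finite_words[where 'a = bool] by (subst sum.union_disjoint[symmetric]) auto
  also have "(\<Sum>q\<in>{q::bool list. length q = Suc K}. (1/2::real) ^ length q) = 1"
    using card_lists_length_eq[of "UNIV :: bool set" "Suc K"] by (simp add: power_one_over)
  finally show ?case using Suc by simp
qed simp

text \<open>The substitute for Kraft's inequality: distinct strings have distinct shortest programs,
  which are compared with all binary strings of length at most \<open>K\<close>. Each length
  contributes exactly 1.\<close>

lemma sum_half_power_I_AIC:
  assumes U: "\<And>s. s \<in> S \<Longrightarrow> \<exists>p. U p = Some s" and K: "\<And>s. s \<in> S \<Longrightarrow> I_AIC U s \<le> K" and "finite S"
  shows "(\<Sum>s\<in>S. (1/2) ^ I_AIC U s) \<le> (real K + 1 :: real)"
proof -
  have "\<forall>s\<in>S. \<exists>p. U p = Some s \<and> length p = I_AIC U s" using U I_AIC_witness by blast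
  then obtain p where p: "\<And>s. s \<in> S \<Longrightarrow> U (p s) = Some s" "\<And>s. s \<in> S \<Longrightarrow> length (p s) = I_AIC U s"
    by (auto simp: bchoice_iff)
  have "inj_on p S" using p(1) by (metis inj_onI option.inject)
  then have "(\<Sum>s\<in>S. (1/2::real) ^ I_AIC U s) = (\<Sum>q\<in>p ` S. (1/2) ^ length q)"
    using p(2) by (simp add: sum.reindex)
  also have "\<dots> \<le> (\<Sum>q\<in>{q::bool list. length q \<le> K}. (1/2) ^ length q)"
    using p(2) K finite_lists_length_le[of "UNIV :: bool set" K] by (intro sum_mono2) auto
  finally show ?thesis by (simp add: sum_half_power_length)
qed

context shift_system begin

lemma range_prefix: "range (prefix l :: (nat \<Rightarrow> 'a) \<Rightarrow> _) = {w. length w = l}"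
proof -
  have "w \<in> range (prefix l)" if "length w = l" for w :: "'a list"
  proof -
    have "w = prefix l (\<lambda>i. w ! i)" using that by (intro nth_equalityI) auto
    then show ?thesis by blast
  qed
  then show ?thesis by auto
qed

text \<open>The windows start at \<open>0, ..., n - length w\<close>. For longer words truncated
  subtraction would still leave one window, whose content the prefix does not determine.\<close>

lemma emp_freq_eq_birkhoff_sum:
  assumes "length w \<le> n"
  shows "emp_freq (prefix n \<omega>) w
    = birkhoff_sum shift (indicator {\<omega>. prefix (length w) \<omega> = w}) (n - length w + 1) \<omega> / real (n - length w + 1)"
proof -
  let ?l = "length w"
  let ?I = "{i \<in> {..<n - ?l + 1}. prefix ?l ((shift ^^ i) \<omega>) = w}"
  have "birkhoff_sum shift (indicator {\<omega>. prefix ?l \<omega> = w}) m \<omega>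
      = real (card {i \<in> {..<m}. prefix ?l ((shift ^^ i) \<omega>) = w})" for m
    unfolding birkhoff_sum_def by (simp add: indicator_def sum_of_bool_eq Collect_conj_eq lessThan_def)
  moreover have "{i. i \<le> n - ?l \<and> take ?l (drop i (prefix n \<omega>)) = w} = ?I"
    using assms by (auto simp: take_drop_prefix)
  ultimately show ?thesis unfolding emp_freq_def by simp
qed

lemma AE_emp_freq_tendsto:
  assumes "ergodic shift M"
  shows "AE \<omega> in M. (\<lambda>n. emp_freq (prefix n \<omega>) w) \<longlonglongrightarrow> law (prefix (length w)) w"
proof -
  let ?l = "length w"
  let ?f = "indicator {\<omega>. prefix ?l \<omega> = w} :: _ \<Rightarrow> real"
  have meas: "{\<omega>. prefix ?l \<omega> = w} \<in> sets M"
    using cylinder_sets[of ?l "{w}"] by simp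
  have exp: "expectation ?f = law (prefix ?l) w"
    using meas by (simp add: law_def vimage_def)
  have "AE \<omega> in M. (\<lambda>n. birkhoff_sum shift ?f n \<omega> / real n) \<longlonglongrightarrow> expectation ?f"
    using meas by (intro birkhoff_ergodic[of _ 1] assms) (auto simp: indicator_def)
  then show ?thesis
  proof eventually_elim
    case (elim \<omega>)
    \<comment> \<open>A prefix of length \<open>n\<close> has \<open>n - ?l + 1\<close> windows, so
      the ergodic averages are read along this index.\<close>
    have "filterlim (\<lambda>n. n - ?l + 1) sequentially sequentially"
      by (rule filterlim_at_top_mono[OF filterlim_minus_const_nat_at_top[of ?l]]) auto
    from filterlim_compose[OF elim this]
    have "(\<lambda>n. birkhoff_sum shift ?f (n - ?l + 1) \<omega> / real (n - ?l + 1)) \<longlonglongrightarrow> law (prefix ?l) w"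
      by (simp only: exp)
    then show ?case
      by (rule Lim_transform_eventually)
         (use emp_freq_eq_birkhoff_sum[of w] in \<open>auto intro!: eventually_sequentiallyI[of ?l]\<close>)
  qed
qed

lemma AE_emp_entropy_tendsto:
  assumes "ergodic shift M"
  shows "AE \<omega> in M. \<forall>l. (\<lambda>n. emp_entropy l (prefix n \<omega>)) \<longlonglongrightarrow> block_entropy l / real l"
proof -
  \<comment> \<open>There are only countably many words, so a single null set serves all words and
    hence all orders \<open>l\<close>.\<close>
  have "AE \<omega> in M. \<forall>w. (\<lambda>n. emp_freq (prefix n \<omega>) w) \<longlonglongrightarrow> law (prefix (length w)) w"
    unfolding AE_all_countable using AE_emp_freq_tendsto[OF assms] by blast
  then show ?thesis
  proof eventually_elim
    case (elim \<omega>)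
    show ?case
    proof
      fix l
      have "(\<lambda>n. emp_freq (prefix n \<omega>) w * log 2 (emp_freq (prefix n \<omega>) w))
          \<longlonglongrightarrow> law (prefix l) w * log 2 (law (prefix l) w)" if "length w = l" for w
        using elim that
        by (intro continuous_on_tendsto_compose[OF continuous_on_mult_log])
           (auto simp: law_nonneg emp_freq_nonneg)
      then have "(\<lambda>n. \<Sum>w\<in>{w. length w = l}. emp_freq (prefix n \<omega>) w * log 2 (emp_freq (prefix n \<omega>) w))
          \<longlonglongrightarrow> (\<Sum>w\<in>{w. length w = l}. law (prefix l) w * log 2 (law (prefix l) w))"
        by (intro tendsto_sum) simp
      then have "(\<lambda>n. emp_entropy l (prefix n \<omega>)) \<longlonglongrightarrow>
          - (1 / real l) * (\<Sum>w\<in>{w. length w = l}. law (prefix l) w * log 2 (law (prefix l) w))"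
        unfolding emp_entropy_def by (rule tendsto_mult[OF tendsto_const])
      moreover have "block_entropy l = - (\<Sum>w\<in>{w. length w = l}. law (prefix l) w * log 2 (law (prefix l) w))"
        by (simp add: fin_entropy_law range_prefix sum_negf)
      ultimately show "(\<lambda>n. emp_entropy l (prefix n \<omega>)) \<longlonglongrightarrow> block_entropy l / real l" by simp
    qed
  qed
qed

text \<open>Gibbs' inequality for the weights 2^-\<open>I_AIC\<close>, normalised by
  \<open>K + 1\<close>: their negative logarithm is \<open>I_AIC\<close> plus the logarithm of the
  normalisation.\<close>

lemma block_entropy_le_expectation_I_AIC:
  assumes U: "\<And>s. \<exists>p. U p = Some s" and K: "\<And>s. length s = n \<Longrightarrow> I_AIC U s \<le> K"
  shows "block_entropy n \<le> expectation (\<lambda>\<omega>. real (I_AIC U (prefix n \<omega>))) + log 2 (real K + 1)"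
proof -
  define Q where "Q s = (1/2) ^ I_AIC U s / (real K + 1)" for s
  have log_Q: "- log 2 (Q s) = real (I_AIC U s) + log 2 (real K + 1)" for s
    by (simp add: Q_def log_divide log_nat_power)
  have "(\<Sum>s\<in>{s. length s = n}. (1/2::real) ^ I_AIC U s) \<le> real K + 1"
    using U K finite_words by (intro sum_half_power_I_AIC) auto
  then have "(\<Sum>s\<in>range (prefix n). Q s) \<le> 1"
    unfolding Q_def range_prefix sum_divide_distrib[symmetric] by simp
  then have "block_entropy n \<le> expectation (\<lambda>\<omega>. - log 2 (Q (prefix n \<omega>)))"
    by (intro gibbs_inequality finite_rv_prefix) (auto simp: Q_def add_pos_nonneg)
  also have "\<dots> = expectation (\<lambda>\<omega>. real (I_AIC U (prefix n \<omega>))) + log 2 (real K + 1)"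
    unfolding log_Q
    using expectation_finite_rv(2)[OF finite_rv_prefix[of n], of "\<lambda>s. real (I_AIC U s)"] by simp
  finally show ?thesis .
qed

text \<open>If the positive parts of the differences vanish in the limit while the means do not drop below
  \<open>h\<close>, then the convergence holds in mean, hence almost surely along a subsequence.\<close>
lemma AE_limsup_ge:
  fixes Y :: "nat \<Rightarrow> (nat \<Rightarrow> 'a) \<Rightarrow> real"
  assumes [measurable]: "\<And>n. Y n \<in> borel_measurable M" and bdd: "\<And>n \<omega>. \<bar>Y n \<omega>\<bar> \<le> B"
    and upper: "AE \<omega> in M. limsup (\<lambda>n. ereal (Y n \<omega>)) \<le> ereal h"
    and mean: "\<And>n. a n \<le> expectation (Y n)" and a: "a \<longlonglongrightarrow> h"
  shows "AE \<omega> in M. limsup (\<lambda>n. ereal (Y n \<omega>)) \<ge> ereal h"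
proof -
  have Y_int: "integrable M (Y n)" for n using bdd by (intro bounded_integrable) auto
  have pos_int: "integrable M (\<lambda>\<omega>. max (Y n \<omega> - h) 0)" for n
  proof (rule bounded_integrable[of _ "B + \<bar>h\<bar>"])
    show "\<bar>max (Y n \<omega> - h) 0\<bar> \<le> B + \<bar>h\<bar>" for \<omega> using bdd[of n \<omega>] by linarith
  qed simp
  have "(\<lambda>n. expectation (\<lambda>\<omega>. max (Y n \<omega> - h) 0)) \<longlonglongrightarrow> expectation (\<lambda>\<omega>. 0)"
  proof (rule integral_dominated_convergence[where w = "\<lambda>\<omega>. B + \<bar>h\<bar>"])
    show "AE \<omega> in M. (\<lambda>n. max (Y n \<omega> - h) 0) \<longlonglongrightarrow> 0"
      using upper
    proof eventually_elim
      case (elim \<omega>)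
      show ?case
      proof (rule LIMSEQ_I)
        fix e :: real assume e: "e > 0"
        then have "limsup (\<lambda>n. ereal (Y n \<omega>)) < ereal (h + e)"
          using elim by (auto intro: le_less_trans)
        then have "eventually (\<lambda>n. ereal (Y n \<omega>) < ereal (h + e)) sequentially" by (rule Limsup_lessD)
        then show "\<exists>N. \<forall>n\<ge>N. norm (max (Y n \<omega> - h) 0 - 0) < e"
          using e by (auto simp: eventually_sequentially diff_less_eq add.commute)
      qed
    qed
    show "AE \<omega> in M. norm (max (Y n \<omega> - h) 0) \<le> B + \<bar>h\<bar>" for n
    proof (rule AE_I2)
      show "norm (max (Y n \<omega> - h) 0) \<le> B + \<bar>h\<bar>" for \<omega> using bdd[of n \<omega>] unfolding real_norm_def by linarith
    qed
  qed auto
  then have pos: "(\<lambda>n. expectation (\<lambda>\<omega>. max (Y n \<omega> - h) 0)) \<longlonglongrightarrow> 0" by simp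
  have "(\<lambda>n. expectation (\<lambda>\<omega>. norm (Y n \<omega> - h))) \<longlonglongrightarrow> 0"
  proof (rule tendsto_sandwich[where f = "\<lambda>_. 0"])
    have "expectation (\<lambda>\<omega>. norm (Y n \<omega> - h)) \<le> 2 * expectation (\<lambda>\<omega>. max (Y n \<omega> - h) 0) + (h - a n)" for n
    proof -
      \<comment> \<open>An absolute value is twice the positive part minus the number itself, so the
        positive part and the mean control the distance in mean.\<close>
      have "expectation (\<lambda>\<omega>. norm (Y n \<omega> - h)) = expectation (\<lambda>\<omega>. 2 * max (Y n \<omega> - h) 0 - (Y n \<omega> - h))"
        by (intro Bochner_Integration.integral_cong) (auto simp: max_def)
      also have "\<dots> = 2 * expectation (\<lambda>\<omega>. max (Y n \<omega> - h) 0) - (expectation (Y n) - h)"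
        using pos_int Y_int by (simp add: prob_space)
      finally show ?thesis using mean[of n] by simp
    qed
    then show "eventually (\<lambda>n. expectation (\<lambda>\<omega>. norm (Y n \<omega> - h))
        \<le> 2 * expectation (\<lambda>\<omega>. max (Y n \<omega> - h) 0) + (h - a n)) sequentially" by simp
    have "(\<lambda>n. 2 * expectation (\<lambda>\<omega>. max (Y n \<omega> - h) 0) + (h - a n)) \<longlonglongrightarrow> 2 * 0 + (h - h)"
      by (intro tendsto_intros pos a)
    then show "(\<lambda>n. 2 * expectation (\<lambda>\<omega>. max (Y n \<omega> - h) 0) + (h - a n)) \<longlonglongrightarrow> 0" by simp
  qed auto
  then obtain r :: "nat \<Rightarrow> nat" where r: "strict_mono r" "AE \<omega> in M. (\<lambda>n. Y (r n) \<omega> - h) \<longlonglongrightarrow> 0"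
    using tendsto_L1_AE_subseq[of M "\<lambda>n \<omega>. Y n \<omega> - h"] Y_int by auto
  from r(2) show ?thesis
  proof eventually_elim
    case (elim \<omega>)
    then have "(\<lambda>n. Y (r n) \<omega>) \<longlonglongrightarrow> h" by (simp add: LIM_zero_iff)
    then have "(\<lambda>n. ereal (Y (r n) \<omega>)) \<longlonglongrightarrow> ereal h" by simp
    then have "limsup ((\<lambda>n. ereal (Y n \<omega>)) \<circ> r) = ereal h"
      by (simp add: lim_imp_Limsup comp_def)
    then show ?case using limsup_subseq_mono[OF r(1), of "\<lambda>n. ereal (Y n \<omega>)"] by simp
  qed
qed

end

section \<open>Bounds for a fixed sequence or string, and the conclusion\<close>

lemma K_Z_le_of_emp_entropy:
  assumes Z: "coarsely_optimal Z" and "k \<ge> 1"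
    and lim: "(\<lambda>n. emp_entropy k (prefix n \<omega>)) \<longlonglongrightarrow> H"
  shows "K_Z Z \<omega> \<le> ereal H"
proof -
  obtain f where f: "f \<in> o(\<lambda>n. real n)"
      "\<And>s. real (length (Z s)) \<le> real (length s) * emp_entropy k s + f (length s)"
    using Z \<open>k \<ge> 1\<close> unfolding coarsely_optimal_def by blast
  have "(\<lambda>n. emp_entropy k (prefix n \<omega>) + f n / real n) \<longlonglongrightarrow> H + 0"
    using smalloD_tendsto[OF f(1)] lim by (intro tendsto_add)
  then have "limsup (\<lambda>n. ereal (emp_entropy k (prefix n \<omega>) + f n / real n)) = ereal H"
    by (intro lim_imp_Limsup) auto
  moreover have "K_Z Z \<omega> \<le> limsup (\<lambda>n. ereal (emp_entropy k (prefix n \<omega>) + f n / real n))"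
    unfolding K_Z_def
  proof (intro Limsup_mono eventually_sequentiallyI[of 1])
    fix n :: nat assume n: "n \<ge> 1"
    have "real (length (Z (prefix n \<omega>))) / real n \<le> (real n * emp_entropy k (prefix n \<omega>) + f n) / real n"
      using f(2)[of "prefix n \<omega>"] by (intro divide_right_mono) auto
    then show "ereal (real (length (Z (prefix n \<omega>))) / real n) \<le> ereal (emp_entropy k (prefix n \<omega>) + f n / real n)"
      using n by (simp add: add_divide_distrib)
  qed
  ultimately show ?thesis by simp
qed

lemma K_AIC_le_K_Z:
  assumes c: "\<And>s. I_AIC U s \<le> length (Z s) + c"
  shows "K_AIC U \<omega> \<le> K_Z Z \<omega>"
proof -
  have "real (I_AIC U (prefix n \<omega>)) / real n \<le> real c / real n + real (length (Z (prefix n \<omega>))) / real n" for n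
  proof -
    have "real (I_AIC U (prefix n \<omega>)) \<le> real c + real (length (Z (prefix n \<omega>)))"
      using c[of "prefix n \<omega>"] by linarith
    from divide_right_mono[OF this, of "real n"] show ?thesis by (simp add: add_divide_distrib)
  qed
  then have "K_AIC U \<omega> \<le> limsup (\<lambda>n. ereal (real c / real n) + ereal (real (length (Z (prefix n \<omega>))) / real n))"
    unfolding K_AIC_def by (intro Limsup_mono always_eventually) simp
  also have "(\<lambda>n. ereal (real c / real n)) \<longlonglongrightarrow> 0"
    using lim_const_over_n[of "real c"] by (simp add: zero_ereal_def)
  then have "limsup (\<lambda>n. ereal (real c / real n) + ereal (real (length (Z (prefix n \<omega>))) / real n)) = K_Z Z \<omega>"
    unfolding K_Z_def using ereal_limsup_lim_add[of "\<lambda>n. ereal (real c / real n)" 0] by (simp del: plus_ereal.simps)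
  finally show ?thesis .
qed

text \<open>Coarse optimality at order 1, where the empirical entropy is uniformly bounded. The
  error function is controlled only for large lengths, hence the threshold
  \<open>n0\<close>.\<close>

lemma I_AIC_linear_bound:
  fixes Z :: "'a::finite list \<Rightarrow> bool list"
  assumes Z: "coarsely_optimal Z" and c: "\<And>s. I_AIC U s \<le> length (Z s) + c"
  shows "\<exists>C n0. \<forall>s. length s \<ge> n0 \<longrightarrow> I_AIC U s \<le> C * length s"
proof -
  obtain f where f: "f \<in> o(\<lambda>n. real n)"
      "\<And>s. real (length (Z s)) \<le> real (length s) * emp_entropy 1 s + f (length s)"
    using Z unfolding coarsely_optimal_def by blast
  have "eventually (\<lambda>n. f n / real n < 1) sequentially"
    using smalloD_tendsto[OF f(1)] by (rule order_tendstoD) simp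
  then obtain n0 where n0: "\<And>n. n \<ge> n0 \<Longrightarrow> f n / real n < 1"
    by (auto simp: eventually_sequentially)
  define A where "A = real (card {w::'a list. length w = 1}) / ln 2"
  \<comment> \<open>The summands pay for the empirical entropy, the sublinear error and the additive
    constant \<open>c\<close>, which is absorbed because the length is at least 1.\<close>
  define C where "C = nat \<lceil>A + 1 + real c\<rceil>"
  have "I_AIC U s \<le> C * length s" if "length s \<ge> Suc n0" for s
  proof -
    let ?n = "length s"
    have "f ?n \<le> real ?n" using n0[of ?n] that by (simp add: divide_less_eq split: if_splits)
    moreover have "real ?n * emp_entropy 1 s \<le> real ?n * A"
      unfolding A_def using emp_entropy_1_le[of s] by (intro mult_left_mono) auto
    moreover have "real c \<le> real ?n * real c" using that by (simp add: mult_le_cancel_right1)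
    ultimately have "real (I_AIC U s) \<le> real ?n * (A + 1 + real c)"
      using f(2)[of s] c[of s] by (simp add: algebra_simps)
    also have "\<dots> \<le> real ?n * real C" unfolding C_def by (intro mult_left_mono real_nat_ceiling_ge) simp
    finally have "real (I_AIC U s) \<le> real (C * ?n)" by (simp add: mult.commute)
    then show ?thesis by (simp only: of_nat_le_iff)
  qed
  then show ?thesis by blast
qed

theorem theorem11:
  fixes M :: "(nat \<Rightarrow> 'a::finite) measure"
    and U :: "bool list \<Rightarrow> 'a list option"
    and Z :: "'a list \<Rightarrow> bool list"
  assumes "sets M = shift_sets"
    and "prob_space M"
    and "invariant_measure shift M"
    and "ergodic shift M"
    and "universal_prf U"
    and "compression_algorithm Z"
    and "coarsely_optimal Z"
  shows "AE \<omega> in M. K_Z Z \<omega> = ereal (KS_entropy M shift)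
                 \<and> emp_entropy_lim \<omega> = ereal (KS_entropy M shift)
                 \<and> K_AIC U \<omega> = ereal (KS_entropy M shift)"
proof -
  interpret shift_system M
    using assms(1-3) by (simp add: shift_system_def shift_system_axioms_def)
  let ?h = "KS_entropy M shift"
  obtain c where U: "\<And>s. \<exists>p. U p = Some s" and c: "\<And>s. I_AIC U s \<le> length (Z s) + c"
    using I_AIC_compression[OF assms(5,6)] by blast
  obtain C n1 where "\<And>s. length s \<ge> n1 \<Longrightarrow> I_AIC U s \<le> C * length s"
    using I_AIC_linear_bound[of Z U c, OF assms(7) c] by blast
  then have C: "I_AIC U s \<le> C * length s" if "length s \<ge> Suc n1" for s using that by simp
  have upper: "AE \<omega> in M. emp_entropy_lim \<omega> = ereal ?h \<and> K_Z Z \<omega> \<le> ereal ?h \<and> K_AIC U \<omega> \<le> K_Z Z \<omega>"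
    using AE_emp_entropy_tendsto[OF assms(4)]
  proof eventually_elim
    case (elim \<omega>)
    have "emp_entropy_seq l \<omega> = ereal (block_entropy l / real l)" for l
      unfolding emp_entropy_seq_def using elim by (intro lim_imp_Limsup) auto
    then have "emp_entropy_lim \<omega> = ereal ?h"
      unfolding emp_entropy_lim_def using block_entropy_tendsto by (intro limI) simp
    moreover have "K_Z Z \<omega> \<le> ereal (block_entropy k / real k)" if "k \<ge> 1" for k
      using K_Z_le_of_emp_entropy[OF assms(7) that] elim by blast
    \<comment> \<open>All orders \<open>k\<close> are available on the same set of full measure, so
      \<open>k\<close> may tend to infinity.\<close>
    then have "K_Z Z \<omega> \<le> ereal ?h"
      using block_entropy_tendsto by (intro LIMSEQ_le_const[of "\<lambda>k. ereal (block_entropy k / real k)"]) auto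
    ultimately show ?case using K_AIC_le_K_Z[of U Z c, OF c] by blast
  qed
  \<comment> \<open>Starting at length \<open>Suc n1\<close> makes the linear bound valid for every
    \<open>n\<close> and excludes division by 0, without changing the upper limit.\<close>
  define Y where "Y n \<omega> = real (I_AIC U (prefix (n + Suc n1) \<omega>)) / real (n + Suc n1)" for n \<omega>
  have limsup_Y: "limsup (\<lambda>n. ereal (Y n \<omega>)) = K_AIC U \<omega>" for \<omega>
    unfolding Y_def K_AIC_def by (rule limsup_shift_k)
  \<comment> \<open>The subtracted logarithm is the price of normalising the program weights with
    \<open>K = C * (n + Suc n1)\<close>.\<close>
  define a where "a n = block_entropy (n + Suc n1) / real (n + Suc n1)
      - log 2 (real (C * (n + Suc n1)) + 1) / real (n + Suc n1)" for n
  have "AE \<omega> in M. limsup (\<lambda>n. ereal (Y n \<omega>)) \<ge> ereal ?h"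
  proof (rule AE_limsup_ge)
    show "Y n \<in> borel_measurable M" for n
      using expectation_finite_rv(2)[OF finite_rv_prefix[of "n + Suc n1"], of "\<lambda>s. real (I_AIC U s) / real (n + Suc n1)"]
      unfolding Y_def[abs_def] by (rule borel_measurable_integrable)
    show "\<bar>Y n \<omega>\<bar> \<le> real C" for n \<omega>
    proof -
      have "I_AIC U (prefix (n + Suc n1) \<omega>) \<le> C * (n + Suc n1)" using C[of "prefix (n + Suc n1) \<omega>"] by simp
      then have "real (I_AIC U (prefix (n + Suc n1) \<omega>)) \<le> real C * real (n + Suc n1)"
        by (simp only: of_nat_mult[symmetric] of_nat_le_iff)
      then show ?thesis by (simp add: Y_def divide_le_eq)
    qed
    show "AE \<omega> in M. limsup (\<lambda>n. ereal (Y n \<omega>)) \<le> ereal ?h"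
      using upper unfolding limsup_Y by eventually_elim (auto intro: order_trans)
    show "a n \<le> expectation (Y n)" for n
    proof -
      have "block_entropy (n + Suc n1) \<le> expectation (\<lambda>\<omega>. real (I_AIC U (prefix (n + Suc n1) \<omega>)))
          + log 2 (real (C * (n + Suc n1)) + 1)"
        by (rule block_entropy_le_expectation_I_AIC[OF U]) (metis C le_add2)
      then have "a n \<le> expectation (\<lambda>\<omega>. real (I_AIC U (prefix (n + Suc n1) \<omega>))) / real (n + Suc n1)"
        unfolding a_def diff_divide_distrib[symmetric] by (intro divide_right_mono) auto
      then show ?thesis by (simp add: Y_def[abs_def])
    qed
    have "(\<lambda>n. log 2 (real (C * n) + 1) / real n) \<longlonglongrightarrow> 0"
    proof (cases "C = 0")
      case False
      then have "real C > 0" by simp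
      then show ?thesis unfolding of_nat_mult by real_asymp
    qed simp
    then have "(\<lambda>n. block_entropy n / real n - log 2 (real (C * n) + 1) / real n) \<longlonglongrightarrow> ?h - 0"
      by (intro tendsto_diff block_entropy_tendsto)
    from LIMSEQ_ignore_initial_segment[OF this, of "Suc n1"] show "a \<longlonglongrightarrow> ?h"
      by (simp only: a_def[abs_def] diff_zero)
  qed
  with upper show ?thesis
    unfolding limsup_Y by eventually_elim (auto intro: order_antisym order_trans)
qed

end
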